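(* Let $n\ge 1$, fix $\alpha>0$, and let $\boldsymbol\gamma=[\gamma_{\{p,q\}}]_{\{p,q\}\in B}$ be a conductivity profile. Let $m\ge 4n$ and let $\mathbf d(k)=(\overline{\mathbf u}(k),\overline{\mathbf v}(k))$, $k=1,\dots,m$, be Cauchy data pairs for $\boldsymbol\gamma$, such that $\{\overline{\mathbf u}(k)\}_{k=1}^m$ contains a basis of $\mathbb R^{4n}$. Consider the network with input data $\widetilde{\mathbf x}^{(1)}(k)=\overline{\mathbf u}(k)$ and $\widehat{\mathbf x}^{(1)}(k)=\overline{\mathbf v}(k)$, $k=1,\dots,m$, and its loss $C_\alpha$. Then there is a unique minimum $\widetilde W_*=(\widetilde W^{(1)}_*,\widetilde W^{(2)}_* )$ of the loss with $C_\alpha(\widetilde W_* )=0$. Moreover, its second-layer coefficient matrix $M=(M_{rp})_{r,p\in\overline D}$ satisfies $$ M_{rp}=\begin{cases} \gamma_{\{p,r\}}, & \{p,r\}\in B,\ r\in D,\\ -\gamma_{\{p,r\}}, & \{p,r\}\in B,\ r\in\partial D,\\ 0, & \{p,r\}\notin B,\ p\neq r,\\ -\sum_{q\in\mathcal N(r)}\gamma_{\{q,r\}}, & p=r\in D,\\ \gamma_{\{q,r\}}, & p=r\in\partial D,\ \{q\}=\mathcal N(r), \end{cases} $$ (equivalently, $\widetilde w^{(2)}_{*,\{p,r\}}=\gamma_{\{p,r\}}$ for all $\{p,r\}\in B$), and the weights $\widetilde w^{(1)}_{*,pq}$, $p\in\partial D$, $q\in D$, are the entries of the matrix that maps the Dirichlet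 datum to the solution $\mathbf u$ in $D$; that is, for every $\overline{\mathbf u}\in\mathbb R^{\partial D}$ the solution $\mathbf u$ of the discrete Dirichlet problem with conductivity $\boldsymbol\gamma$ and datum $\overline{\mathbf u}$ satisfies $u_q=\sum_{p\in\partial D}\widetilde w^{(1)}_{*,pq}\,\overline u_p$ for all $q\in D$.
   Context: Lattice. $D=\{(i,j): i,j=1,\dots,n\}$; $\partial D$ consists of the $4n$ points $(0,j),(n+1,j)$ for $1\le j\le n$ and $(i,0),(i,n+1)$ for $1\le i\le n$; $\overline D=D\cup\partial D$. $B$ is the set of edges $\{p,q\}$ with $p=(i,j),q=(i',j')\in\overline D$, $|i-i'|+|j-j'|=1$, and at least one of $p,q$ in $D$ (so $|B|=2n(n+1)$). $\mathcal N(p)$ is the set of $q$ with $\{p,q\}\in B$; it has four elements if $p\in D$ and exactly one element (in $D$) if $p\in\partial D$. $\mathbb R^{\partial D}$ is identified with $\mathbb R^{4n}$. Conductivity problem. A conductivity profile assigns a number $\gamma_{\{p,q\}}>0$ to each edge in $B$. For $\overline{\mathbf u}\in\mathbb R^{\partial D}$ there is a unique $\mathbf u=[u_p]_{p\in\overline D}$ solving the discrete Dirichlet problem $\sum_{q\in\mathcal N(p)}\gamma_{\{q,p\}}(u_q-u_p)=0$ for $p\in D$ and $u_q=\overline u_q$ for $q\in\partial D$. A Cauchy data pair for $\boldsymbol\gamma$ is $(\overline{\mathbf u},\overline{\mathbf v})$ with $\overline v_q=\gamma_{\{q,p\}}(u_q-u_p)$ for $q\in\partial D$, $\mathcal N(q)=\{p\}$.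 Network. The trainable parameters are $\widetilde W=(\widetilde W^{(1)},\widetilde W^{(2)})$: $\widetilde W^{(1)}$ consists of arbitrary real weights $\widetilde w^{(1)}_{qp}$, $q\in\partial D$, $p\in D$; $\widetilde W^{(2)}$ consists of arbitrary real (symmetric) edge weights $\widetilde w^{(2)}_{\{p,r\}}=\widetilde w^{(2)}_{pr}=\widetilde w^{(2)}_{rp}$, $\{p,r\}\in B$. Given inputs $\widetilde{\mathbf x}^{(1)},\widehat{\mathbf x}^{(1)}\in\mathbb R^{\partial D}$, the hidden layer is $\widetilde x^{(2)}_q=\widetilde x^{(1)}_q$ for $q\in\partial D$, $\widetilde x^{(2)}_p=\sum_{q\in\partial D}\widetilde w^{(1)}_{qp}\widetilde x^{(1)}_q$ for $p\in D$, and $\widehat x^{(2)}_q=\widehat x^{(1)}_q$ for $q\in\partial D$. The output $\mathbf y\in\mathbb R^{\overline D}$ is $$y_r=\sum_{p\in\mathcal N(r)}\widetilde w^{(2)}_{pr}(\widetilde x^{(2)}_p-\widetilde x^{(2)}_r)\ (r\in D),\qquad y_r=\widetilde w^{(2)}_{pr}(\widetilde x^{(2)}_r-\widetilde x^{(2)}_p)-\widehat x^{(2)}_r\ (r\in\partial D,\ \mathcal N(r)=\{p\}).$$ The second-layer coefficient matrix $M$ is the matrix for which $y_r=\sum_{p\in\overline D}M_{rp}\widetilde x^{(2)}_p$ for $r\in D$ and $y_r=\sum_{p\in\overline D}M_{rp}\widetilde x^{(2)}_p-\widehat x^{(2)}_r$ for $r\in\partial D$; that is, $M_{rp}=\widetilde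 w^{(2)}_{\{p,r\}}$ if $r\in D$, $\{p,r\}\in B$; $M_{rr}=-\sum_{p\in\mathcal N(r)}\widetilde w^{(2)}_{pr}$ if $r\in D$; $M_{rp}=-\widetilde w^{(2)}_{\{p,r\}}$ and $M_{rr}=\widetilde w^{(2)}_{\{p,r\}}$ if $r\in\partial D$, $\mathcal N(r)=\{p\}$; and all other entries are $0$. Loss. With $\mathbf y(k)$ the output for the $k$-th input pair, $$C_\alpha(\widetilde W)=\frac1{2m}\sum_{k=1}^m\Big(\sum_{p\in\partial D}y_p(k)^2+\alpha\sum_{p\in D}y_p(k)^2\Big).$$ A minimum is a global minimizer of $C_\alpha$ over all trainable parameters $\widetilde W$. *)

theory Defs
  imports Complex_Main "HOL-Library.Function_Algebras"
begin

section \<open>Real vectors indexed by a finite set\<close>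

text \<open>
  The space of real vectors indexed by a set \<open>A\<close> is rendered as the set of all functions that
  vanish outside \<open>A\<close>, so that equality of vectors is equality of functions.  Linear span and
  linear independence are those of \<^locale>\<open>module\<close>, for the pointwise operations.
\<close>

definition vecs :: "'a set \<Rightarrow> ('a \<Rightarrow> real) set" where
  "vecs A = {f. \<forall>x. x \<notin> A \<longrightarrow> f x = 0}"

definition fscale :: "real \<Rightarrow> ('a \<Rightarrow> real) \<Rightarrow> 'a \<Rightarrow> real" where
  "fscale c f = (\<lambda>x. c * f x)"

lemma vector_space_fscale: "vector_space (fscale :: real \<Rightarrow> ('a \<Rightarrow> real) \<Rightarrow> 'a \<Rightarrow> real)"
  by unfold_locales (auto simp: fscale_def fun_eq_iff algebra_simps)

lemma module_fscale: "module (fscale :: real \<Rightarrow> ('a \<Rightarrow> real) \<Rightarrow> 'a \<Rightarrow> real)"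
  using vector_space_fscale by (simp add: module_iff_vector_space)

definition basis_of_vecs :: "'a set \<Rightarrow> ('a \<Rightarrow> real) set \<Rightarrow> bool" where
  "basis_of_vecs A S \<longleftrightarrow> \<not> module.dependent fscale S \<and> module.span fscale S = vecs A"


section \<open>The lattice\<close>

type_synonym point = "int \<times> int"

definition interior_pts :: "nat \<Rightarrow> point set" where
  "interior_pts n = {1..int n} \<times> {1..int n}"

definition boundary_pts :: "nat \<Rightarrow> point set" where
  "boundary_pts n = {0, int n + 1} \<times> {1..int n} \<union> {1..int n} \<times> {0, int n + 1}"

definition closure_pts :: "nat \<Rightarrow> point set" where
  "closure_pts n = interior_pts n \<union> boundary_pts n"

definition edges :: "nat \<Rightarrow> point set set" where
  "edges n = {{p, q} | p q. p \<in> closure_pts n \<and> q \<in> closure_pts n \<and>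
     \<bar>fst p - fst q\<bar> + \<bar>snd p - snd q\<bar> = 1 \<and> (p \<in> interior_pts n \<or> q \<in> interior_pts n)}"

definition nbrs :: "nat \<Rightarrow> point \<Rightarrow> point set" where
  "nbrs n p = {q. {p, q} \<in> edges n}"

text \<open>Only meaningful for a boundary point, which has exactly one neighbour.\<close>

definition bnbr :: "nat \<Rightarrow> point \<Rightarrow> point" where
  "bnbr n q = the_elem (nbrs n q)"


section \<open>The conductivity problem\<close>

definition conductivity_profile :: "nat \<Rightarrow> (point set \<Rightarrow> real) \<Rightarrow> bool" where
  "conductivity_profile n \<gamma> \<longleftrightarrow> (\<forall>e\<in>edges n. \<gamma> e > 0)"

definition dirichlet_solution ::
    "nat \<Rightarrow> (point set \<Rightarrow> real) \<Rightarrow> (point \<Rightarrow> real) \<Rightarrow> (point \<Rightarrow> real) \<Rightarrow> bool" where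
  "dirichlet_solution n \<gamma> ub u \<longleftrightarrow>
     u \<in> vecs (closure_pts n) \<and>
     (\<forall>p\<in>interior_pts n. (\<Sum>q\<in>nbrs n p. \<gamma> {q, p} * (u q - u p)) = 0) \<and>
     (\<forall>q\<in>boundary_pts n. u q = ub q)"

definition cauchy_pair ::
    "nat \<Rightarrow> (point set \<Rightarrow> real) \<Rightarrow> (point \<Rightarrow> real) \<times> (point \<Rightarrow> real) \<Rightarrow> bool" where
  "cauchy_pair n \<gamma> d \<longleftrightarrow>
     fst d \<in> vecs (boundary_pts n) \<and> snd d \<in> vecs (boundary_pts n) \<and>
     (\<exists>u. dirichlet_solution n \<gamma> (fst d) u \<and>
       (\<forall>q\<in>boundary_pts n. snd d q = \<gamma> {q, bnbr n q} * (u q - u (bnbr n q))))"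


section \<open>The network\<close>

text \<open>
  A parameter is a pair \<open>(W1, W2)\<close>; \<open>W1 (q, p)\<close> is the first-layer weight from the boundary
  point \<open>q\<close> to the interior point \<open>p\<close>, and \<open>W2 e\<close> is the second-layer weight of the edge \<open>e\<close>.
\<close>

type_synonym params = "(point \<times> point \<Rightarrow> real) \<times> (point set \<Rightarrow> real)"

definition param_space :: "nat \<Rightarrow> params set" where
  "param_space n = vecs (boundary_pts n \<times> interior_pts n) \<times> vecs (edges n)"

definition hidden_tilde ::
    "nat \<Rightarrow> (point \<times> point \<Rightarrow> real) \<Rightarrow> (point \<Rightarrow> real) \<Rightarrow> point \<Rightarrow> real" where
  "hidden_tilde n W1 xt r =
     (if r \<in> boundary_pts n then xt r
      else if r \<in> interior_pts n then (\<Sum>q\<in>boundary_pts n. W1 (q, r) * xt q)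
      else 0)"

definition hidden_hat :: "nat \<Rightarrow> (point \<Rightarrow> real) \<Rightarrow> point \<Rightarrow> real" where
  "hidden_hat n xh r = (if r \<in> boundary_pts n then xh r else 0)"

definition second_layer ::
    "nat \<Rightarrow> (point set \<Rightarrow> real) \<Rightarrow> (point \<Rightarrow> real) \<Rightarrow> (point \<Rightarrow> real) \<Rightarrow> point \<Rightarrow> real" where
  "second_layer n W2 xt xh r =
     (if r \<in> interior_pts n then (\<Sum>p\<in>nbrs n r. W2 {p, r} * (xt p - xt r))
      else if r \<in> boundary_pts n then W2 {bnbr n r, r} * (xt r - xt (bnbr n r)) - xh r
      else 0)"

definition network_output ::
    "nat \<Rightarrow> params \<Rightarrow> (point \<Rightarrow> real) \<Rightarrow> (point \<Rightarrow> real) \<Rightarrow> point \<Rightarrow> real" where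
  "network_output n W xt xh =
     second_layer n (snd W) (hidden_tilde n (fst W) xt) (hidden_hat n xh)"

text \<open>
  The argument order is \<open>coeff_matrix n W2 r p\<close> for the entry in row \<open>r\<close> and column \<open>p\<close>;
  that this is the matrix representing the second layer is lemma \<open>second_layer_eq_coeff_matrix\<close>.
\<close>

definition coeff_matrix :: "nat \<Rightarrow> (point set \<Rightarrow> real) \<Rightarrow> point \<Rightarrow> point \<Rightarrow> real" where
  "coeff_matrix n W2 r p =
     (if r \<in> interior_pts n then
        (if {p, r} \<in> edges n then W2 {p, r}
         else if p = r then - (\<Sum>q\<in>nbrs n r. W2 {q, r})
         else 0)
      else if r \<in> boundary_pts n then
        (if {p, r} \<in> edges n then - W2 {p, r}
         else if p = r then W2 {bnbr n r, r}
         else 0)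
      else 0)"

definition loss ::
    "nat \<Rightarrow> real \<Rightarrow> nat \<Rightarrow> (nat \<Rightarrow> (point \<Rightarrow> real) \<times> (point \<Rightarrow> real)) \<Rightarrow> params \<Rightarrow> real" where
  "loss n \<alpha> m d W = 1 / (2 * real m) *
     (\<Sum>k=1..m.
        (\<Sum>p\<in>boundary_pts n. (network_output n W (fst (d k)) (snd (d k)) p)\<^sup>2) +
        \<alpha> * (\<Sum>p\<in>interior_pts n. (network_output n W (fst (d k)) (snd (d k)) p)\<^sup>2))"

definition is_minimum ::
    "nat \<Rightarrow> real \<Rightarrow> nat \<Rightarrow> (nat \<Rightarrow> (point \<Rightarrow> real) \<times> (point \<Rightarrow> real)) \<Rightarrow> params \<Rightarrow> bool" where
  "is_minimum n \<alpha> m d W \<longleftrightarrow> is_arg_min (loss n \<alpha> m d) (\<lambda>W'. W' \<in> param_space n) W"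


section \<open>Basic facts\<close>

lemma finite_closure_pts: "finite (closure_pts n)"
  by (auto simp: closure_pts_def interior_pts_def boundary_pts_def)

lemma interior_boundary_disjoint: "interior_pts n \<inter> boundary_pts n = {}"
  by (auto simp: interior_pts_def boundary_pts_def)

lemma mem_nbrs_iff:
  "q \<in> nbrs n p \<longleftrightarrow> p \<in> closure_pts n \<and> q \<in> closure_pts n \<and>
     \<bar>fst p - fst q\<bar> + \<bar>snd p - snd q\<bar> = 1 \<and> (p \<in> interior_pts n \<or> q \<in> interior_pts n)"
proof
  assume "q \<in> nbrs n p"
  then show "p \<in> closure_pts n \<and> q \<in> closure_pts n \<and>
     \<bar>fst p - fst q\<bar> + \<bar>snd p - snd q\<bar> = 1 \<and> (p \<in> interior_pts n \<or> q \<in> interior_pts n)"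
    unfolding nbrs_def edges_def
    by (auto simp: doubleton_eq_iff abs_minus_commute)
next
  assume "p \<in> closure_pts n \<and> q \<in> closure_pts n \<and>
     \<bar>fst p - fst q\<bar> + \<bar>snd p - snd q\<bar> = 1 \<and> (p \<in> interior_pts n \<or> q \<in> interior_pts n)"
  then show "q \<in> nbrs n p"
    unfolding nbrs_def edges_def by blast
qed

lemma edge_iff_nbrs: "{q, p} \<in> edges n \<longleftrightarrow> q \<in> nbrs n p"
  by (simp add: nbrs_def insert_commute)

lemma nbrs_subset: "nbrs n p \<subseteq> closure_pts n"
  by (auto simp: mem_nbrs_iff)

lemma not_self_nbr: "p \<notin> nbrs n p"
  by (simp add: mem_nbrs_iff)

lemma unit_dist_iff:
  fixes i j k l :: int
  shows "\<bar>i - k\<bar> + \<bar>j - l\<bar> = 1 \<longleftrightarrow>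
    k = i - 1 \<and> l = j \<or> k = i + 1 \<and> l = j \<or> k = i \<and> l = j - 1 \<or> k = i \<and> l = j + 1"
  by arith

lemma nbrs_interior:
  assumes "(i, j) \<in> interior_pts n"
  shows "nbrs n (i, j) = {(i - 1, j), (i + 1, j), (i, j - 1), (i, j + 1)}"
proof -
  have "(i - 1, j) \<in> closure_pts n" "(i + 1, j) \<in> closure_pts n"
    "(i, j - 1) \<in> closure_pts n" "(i, j + 1) \<in> closure_pts n" "(i, j) \<in> closure_pts n"
    using assms by (simp_all add: closure_pts_def interior_pts_def boundary_pts_def) arith+
  with assms show ?thesis
    by (auto simp only: set_eq_iff mem_nbrs_iff split_paired_all split_paired_All fst_conv snd_conv
        unit_dist_iff insert_iff empty_iff prod.inject)
qed

lemma nbrs_boundary: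
  assumes "q \<in> boundary_pts n"
  shows "nbrs n q = {bnbr n q}" and "bnbr n q \<in> interior_pts n"
proof -
  obtain i j where q: "q = (i, j)" by (cases q)
  define p where "p = (if i = 0 then (1, j) else if i = int n + 1 then (int n, j)
     else if j = 0 then (i, 1) else (i, int n))"
  consider "i = 0" "1 \<le> j" "j \<le> int n" | "i = int n + 1" "1 \<le> j" "j \<le> int n"
    | "j = 0" "1 \<le> i" "i \<le> int n" | "j = int n + 1" "1 \<le> i" "i \<le> int n"
    using assms by (auto simp: q boundary_pts_def)
  note cases = this
  have pD: "p \<in> interior_pts n"
    by (rule cases) (simp_all add: p_def interior_pts_def)
  have "q' \<in> nbrs n q \<longleftrightarrow> q' = p" for q'
  proof -
    obtain k l where q': "q' = (k, l)" by (cases q')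
    have "q \<notin> interior_pts n"
      using assms interior_boundary_disjoint[of n] by blast
    then have "q' \<in> nbrs n q \<longleftrightarrow> q' \<in> interior_pts n \<and> \<bar>i - k\<bar> + \<bar>j - l\<bar> = 1"
      using assms by (auto simp: mem_nbrs_iff closure_pts_def q q')
    also have "\<dots> \<longleftrightarrow> q' = p"
      unfolding unit_dist_iff q'
      by (rule cases) (auto simp: p_def interior_pts_def)
    finally show ?thesis .
  qed
  then have "nbrs n q = {p}" by blast
  with pD show "nbrs n q = {bnbr n q}" "bnbr n q \<in> interior_pts n"
    by (auto simp: bnbr_def)
qed

lemma card_boundary_pts: "card (boundary_pts n) = 4 * n"
proof -
  have "({0, int n + 1} \<times> {1..int n}) \<inter> ({1..int n} \<times> {0, int n + 1}) = {}" by auto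
  then show ?thesis
    by (simp add: boundary_pts_def card_Un_disjoint card_cartesian_product)
qed

lemma second_layer_eq_coeff_matrix:
  assumes r: "r \<in> closure_pts n"
  shows "second_layer n W2 xt xh r =
    (\<Sum>p\<in>closure_pts n. coeff_matrix n W2 r p * xt p) - (if r \<in> boundary_pts n then xh r else 0)"
proof -
  define c where "c = coeff_matrix n W2 r"
  have fin: "finite (nbrs n r)"
    using finite_subset[OF nbrs_subset finite_closure_pts] .
  have "(\<Sum>p\<in>closure_pts n. c p * xt p) = (\<Sum>p\<in>insert r (nbrs n r). c p * xt p)"
    using r nbrs_subset[of n r]
    by (intro sum.mono_neutral_right)
       (auto simp: finite_closure_pts c_def coeff_matrix_def edge_iff_nbrs)
  also have "\<dots> = c r * xt r + (\<Sum>p\<in>nbrs n r. c p * xt p)"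
    by (simp add: fin not_self_nbr)
  finally have *: "(\<Sum>p\<in>closure_pts n. c p * xt p) = c r * xt r + (\<Sum>p\<in>nbrs n r. c p * xt p)" .
  show ?thesis
  proof (cases "r \<in> interior_pts n")
    case True
    then have nb: "r \<notin> boundary_pts n" using interior_boundary_disjoint[of n] by blast
    have "c r = - (\<Sum>q\<in>nbrs n r. W2 {q, r})"
      using True not_self_nbr[of r n] edge_iff_nbrs[of r r n] by (simp add: c_def coeff_matrix_def)
    moreover have "(\<Sum>p\<in>nbrs n r. c p * xt p) = (\<Sum>p\<in>nbrs n r. W2 {p, r} * xt p)"
      using True by (intro sum.cong) (auto simp: c_def coeff_matrix_def edge_iff_nbrs)
    ultimately show ?thesis
      using * True nb unfolding c_def[symmetric]
      by (simp add: second_layer_def right_diff_distrib sum_subtractf sum_distrib_right)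
  next
    case False
    then have b: "r \<in> boundary_pts n" using r by (auto simp: closure_pts_def)
    have "c r = W2 {bnbr n r, r}"
      using False b not_self_nbr[of r n] edge_iff_nbrs[of r r n]
      by (simp add: c_def coeff_matrix_def)
    moreover have "c (bnbr n r) = - W2 {bnbr n r, r}"
      using False b nbrs_boundary(1)[OF b] by (simp add: c_def coeff_matrix_def edge_iff_nbrs)
    ultimately show ?thesis
      using * False b nbrs_boundary(1)[OF b] unfolding c_def[symmetric]
      by (simp add: second_layer_def right_diff_distrib)
  qed
qed

end

theory Submission
  imports Defs
begin

text \<open>
  The loss is a sum of squares, so its value is zero exactly when every output vanishes on the
  given data.  Interior outputs vanish when the hidden layer, extended by the boundary datum, is
  harmonic for the second-layer weights; boundary outputs vanish when its boundary fluxes for these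
  weights are the measured ones.  The parameters made of \<open>\<gamma>\<close> and its Dirichlet solution matrix
  achieve this.  Both conditions are linear in the Dirichlet datum and a basis is among the data,
  so a minimizer has vanishing output for every Cauchy pair of \<open>\<gamma>\<close>: its second layer reproduces
  all Cauchy data of \<open>\<gamma>\<close>.  It remains to see that weights of arbitrary sign, zero included,
  that do so are equal to \<open>\<gamma>\<close> (\<open>reproducing_weights_unique\<close>).  Then the hidden layer solves the
  Dirichlet problem of \<open>\<gamma>\<close>, whose solution is unique by the maximum principle.

  The tool for the second layer is marching: if no horizontal weight is zero, the equation at
  \<open>(i, j)\<close> gives the value at \<open>(i + 1, j)\<close> from the columns \<open>i - 1\<close> and \<open>i\<close>.  Hence harmonic
  functions for \<open>\<gamma>\<close> exist with arbitrary values on two adjacent columns and on the top and bottom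
  sides, and on the left part of the square a harmonic function is determined by its Cauchy data
  there.

  First, no horizontal weight of the reproducing network is zero
  (\<open>horizontal_weights_nonzero\<close>).  At the left side this holds because \<open>\<gamma>\<close> has data with nonzero
  flux through each edge.  At the leftmost zero weight to the right of some \<open>(i, j)\<close>, the equation
  would be a nontrivial linear relation between columns \<open>i - 1\<close> and \<open>i\<close>; but marching back from
  column \<open>i\<close> and then forward with \<open>\<gamma>\<close> shows that these columns take arbitrary values.

  Second, with all horizontal weights nonzero, marching works for the unknown weights too.  The
  argument is then that of Curtis and Morrow: for every \<open>t \<le> n\<close> there is a function harmonic for
  \<open>\<gamma>\<close> that is zero for \<open>i + j > t\<close> and nowhere zero on the antidiagonal \<open>i + j = t\<close>
  (\<open>antidiagonal_solution\<close>).  Its Cauchy data force the reproducing function to vanish in the same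
  region.  Walking along the antidiagonal from the boundary, each equation contains one unknown
  weight with a nonzero factor, so the weights are determined
  (\<open>weights_below_antidiagonal\<close>).  Levels \<open>t = 1, \<dots>, n\<close> give the triangle below the main
  antidiagonal, and rotating the square by a half turn gives the other one.
\<close>

section \<open>Networks on a square in coordinates\<close>

type_synonym grid_fun = "int \<Rightarrow> int \<Rightarrow> real"

text \<open>
  A network is given by functions \<open>h\<close> and \<open>v\<close>: the edge from \<open>(i, j)\<close> to \<open>(i + 1, j)\<close> has weight
  \<open>h i j\<close>, the edge from \<open>(i, j)\<close> to \<open>(i, j + 1)\<close> has weight \<open>v i j\<close>.  Working with two functions
  of coordinates instead of a function on edges makes reflections of the square plain substitutions.
\<close>

definition net_flow :: "grid_fun \<Rightarrow> grid_fun \<Rightarrow> grid_fun \<Rightarrow> int \<Rightarrow> int \<Rightarrow> real"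
  where "net_flow h v f i j =
    h i j * (f (i + 1) j - f i j) + h (i - 1) j * (f (i - 1) j - f i j) +
    v i j * (f i (j + 1) - f i j) + v i (j - 1) * (f i (j - 1) - f i j)"

definition harmonic :: "int \<Rightarrow> grid_fun \<Rightarrow> grid_fun \<Rightarrow> grid_fun \<Rightarrow> bool"
  where "harmonic n h v f \<longleftrightarrow> (\<forall>i\<in>{1..n}. \<forall>j\<in>{1..n}. net_flow h v f i j = 0)"

text \<open>
  The four lines are the left, right, bottom and top side.  For nonzero weights a side determines the
  values on the first line of interior points next to it.
\<close>

definition same_cauchy_data :: "int \<Rightarrow> grid_fun \<Rightarrow> grid_fun \<Rightarrow> grid_fun \<Rightarrow>
    grid_fun \<Rightarrow> grid_fun \<Rightarrow> grid_fun \<Rightarrow> bool"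
  where "same_cauchy_data n h v f h' v' f' \<longleftrightarrow> (\<forall>k\<in>{1..n}.
    (f' 0 k = f 0 k \<and> h' 0 k * (f' 0 k - f' 1 k) = h 0 k * (f 0 k - f 1 k)) \<and>
    (f' (n + 1) k = f (n + 1) k \<and> h' n k * (f' (n + 1) k - f' n k) = h n k * (f (n + 1) k - f n k)) \<and>
    (f' k 0 = f k 0 \<and> v' k 0 * (f' k 0 - f' k 1) = v k 0 * (f k 0 - f k 1)) \<and>
    (f' k (n + 1) = f k (n + 1) \<and> v' k n * (f' k (n + 1) - f' k n) = v k n * (f k (n + 1) - f k n)))"

text \<open>
  In the application \<open>h'\<close>, \<open>v'\<close> are the second layer of a network with zero loss, \<open>h\<close>, \<open>v\<close> are the
  conductivities, \<open>f\<close> is a potential and \<open>f'\<close> the hidden layer for the boundary values of \<open>f\<close>.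
\<close>

definition reproduces :: "int \<Rightarrow> grid_fun \<Rightarrow> grid_fun \<Rightarrow>
    grid_fun \<Rightarrow> grid_fun \<Rightarrow> bool"
  where "reproduces n h' v' h v \<longleftrightarrow>
    (\<forall>f. harmonic n h v f \<longrightarrow> (\<exists>f'. harmonic n h' v' f' \<and> same_cauchy_data n h v f h' v' f'))"

lemma net_flow_diff:
  "net_flow h v (\<lambda>i j. f i j - g i j) i j = net_flow h v f i j - net_flow h v g i j"
  by (simp add: net_flow_def algebra_simps)

lemma harmonicD: "harmonic n h v f \<Longrightarrow> 1 \<le> i \<Longrightarrow> i \<le> n \<Longrightarrow> 1 \<le> j \<Longrightarrow> j \<le> n \<Longrightarrow> net_flow h v f i j = 0"
  by (simp add: harmonic_def)

lemma same_cauchy_dataD: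
  assumes "same_cauchy_data n h v f h' v' f'" "1 \<le> k" "k \<le> n"
  shows "f' 0 k = f 0 k" "h' 0 k * (f' 0 k - f' 1 k) = h 0 k * (f 0 k - f 1 k)"
    "f' (n + 1) k = f (n + 1) k" "h' n k * (f' (n + 1) k - f' n k) = h n k * (f (n + 1) k - f n k)"
    "f' k 0 = f k 0" "v' k 0 * (f' k 0 - f' k 1) = v k 0 * (f k 0 - f k 1)"
    "f' k (n + 1) = f k (n + 1)" "v' k n * (f' k (n + 1) - f' k n) = v k n * (f k (n + 1) - f k n)"
proof -
  from assms(2,3) have "k \<in> {1..n}" by simp
  from assms(1)[unfolded same_cauchy_data_def, rule_format, OF this]
  show "f' 0 k = f 0 k" "h' 0 k * (f' 0 k - f' 1 k) = h 0 k * (f 0 k - f 1 k)"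
    "f' (n + 1) k = f (n + 1) k" "h' n k * (f' (n + 1) k - f' n k) = h n k * (f (n + 1) k - f n k)"
    "f' k 0 = f k 0" "v' k 0 * (f' k 0 - f' k 1) = v k 0 * (f k 0 - f k 1)"
    "f' k (n + 1) = f k (n + 1)" "v' k n * (f' k (n + 1) - f' k n) = v k n * (f k (n + 1) - f k n)"
    by blast+
qed

text \<open>
  The half turn maps the left end of a horizontal edge to the right end of its image, whence \<open>n - i\<close>
  and not \<open>n + 1 - i\<close> in the argument of \<open>h\<close>; similarly for \<open>v\<close>.
\<close>

lemma net_flow_rotate:
  "net_flow (\<lambda>i j. h (n - i) (n + 1 - j)) (\<lambda>i j. v (n + 1 - i) (n - j)) (\<lambda>i j. f (n + 1 - i) (n + 1 - j)) i j
    = net_flow h v f (n + 1 - i) (n + 1 - j)"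
  by (simp add: net_flow_def algebra_simps)

lemma harmonic_rotate:
  assumes "harmonic n h v f"
  shows "harmonic n (\<lambda>i j. h (n - i) (n + 1 - j)) (\<lambda>i j. v (n + 1 - i) (n - j)) (\<lambda>i j. f (n + 1 - i) (n + 1 - j))"
  using assms by (simp add: harmonic_def net_flow_rotate)

lemma reproduces_rotate:
  assumes "reproduces n h' v' h v"
  shows "reproduces n (\<lambda>i j. h' (n - i) (n + 1 - j)) (\<lambda>i j. v' (n + 1 - i) (n - j))
    (\<lambda>i j. h (n - i) (n + 1 - j)) (\<lambda>i j. v (n + 1 - i) (n - j))"
  unfolding reproduces_def
proof (intro allI impI)
  fix f assume "harmonic n (\<lambda>i j. h (n - i) (n + 1 - j)) (\<lambda>i j. v (n + 1 - i) (n - j)) f"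
  from harmonic_rotate[OF this] have "harmonic n h v (\<lambda>i j. f (n + 1 - i) (n + 1 - j))"
    by simp
  with assms obtain f' where f': "harmonic n h' v' f'"
      "same_cauchy_data n h v (\<lambda>i j. f (n + 1 - i) (n + 1 - j)) h' v' f'"
    unfolding reproduces_def by blast
  have "same_cauchy_data n (\<lambda>i j. h (n - i) (n + 1 - j)) (\<lambda>i j. v (n + 1 - i) (n - j)) f
      (\<lambda>i j. h' (n - i) (n + 1 - j)) (\<lambda>i j. v' (n + 1 - i) (n - j)) (\<lambda>i j. f' (n + 1 - i) (n + 1 - j))"
    unfolding same_cauchy_data_def
  proof
    fix k assume "k \<in> {1..n}"
    then have "1 \<le> n + 1 - k" "n + 1 - k \<le> n" by auto
    from same_cauchy_dataD[OF f'(2) this]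
    show "(f' (n + 1 - 0) (n + 1 - k) = f 0 k \<and>
          h' (n - 0) (n + 1 - k) * (f' (n + 1 - 0) (n + 1 - k) - f' (n + 1 - 1) (n + 1 - k)) =
          h (n - 0) (n + 1 - k) * (f 0 k - f 1 k)) \<and>
         (f' (n + 1 - (n + 1)) (n + 1 - k) = f (n + 1) k \<and>
          h' (n - n) (n + 1 - k) * (f' (n + 1 - (n + 1)) (n + 1 - k) - f' (n + 1 - n) (n + 1 - k)) =
          h (n - n) (n + 1 - k) * (f (n + 1) k - f n k)) \<and>
         (f' (n + 1 - k) (n + 1 - 0) = f k 0 \<and>
          v' (n + 1 - k) (n - 0) * (f' (n + 1 - k) (n + 1 - 0) - f' (n + 1 - k) (n + 1 - 1)) =
          v (n + 1 - k) (n - 0) * (f k 0 - f k 1)) \<and>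
         f' (n + 1 - k) (n + 1 - (n + 1)) = f k (n + 1) \<and>
         v' (n + 1 - k) (n - n) * (f' (n + 1 - k) (n + 1 - (n + 1)) - f' (n + 1 - k) (n + 1 - n)) =
         v (n + 1 - k) (n - n) * (f k (n + 1) - f k n)"
      by simp
  qed
  with harmonic_rotate[OF f'(1)] show "\<exists>f'. harmonic n (\<lambda>i j. h' (n - i) (n + 1 - j)) (\<lambda>i j. v' (n + 1 - i) (n - j)) f' \<and>
      same_cauchy_data n (\<lambda>i j. h (n - i) (n + 1 - j)) (\<lambda>i j. v (n + 1 - i) (n - j)) f
      (\<lambda>i j. h' (n - i) (n + 1 - j)) (\<lambda>i j. v' (n + 1 - i) (n - j)) f'"
    by blast
qed

section \<open>Marching from column to column\<close>

text \<open>
  Column \<open>k\<close> of a harmonic function with columns \<open>c0\<close> and \<open>c1\<close> at the left, values \<open>b\<close> on the bottom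
  side and zero on the top side; each value is obtained by solving the equation at its left neighbour.
\<close>

fun march :: "int \<Rightarrow> grid_fun \<Rightarrow> grid_fun \<Rightarrow> (int \<Rightarrow> real) \<Rightarrow> (int \<Rightarrow> real) \<Rightarrow> (int \<Rightarrow> real) \<Rightarrow>
    nat \<Rightarrow> int \<Rightarrow> real" where
  "march n h v b c0 c1 0 = c0"
| "march n h v b c0 c1 (Suc 0) = (\<lambda>j. if j = 0 then b 1 else if j = n + 1 then 0 else c1 j)"
| "march n h v b c0 c1 (Suc (Suc k)) =
    (let l = march n h v b c0 c1 k; m = march n h v b c0 c1 (Suc k); i = int (Suc k) in
     (\<lambda>j. if j = 0 then b (i + 1) else if j = n + 1 then 0 else
       m j - (h (i - 1) j * (l j - m j) + v i j * (m (j + 1) - m j) + v i (j - 1) * (m (j - 1) - m j)) / h i j))"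

text \<open>
  The column bound \<open>m\<close> is independent of the height \<open>n\<close> because the march is also used on a part of the
  square, backwards from a column in its middle.
\<close>

lemma march_exists:
  fixes n m :: int
  assumes h: "\<And>i j. 1 \<le> i \<Longrightarrow> i \<le> m \<Longrightarrow> 1 \<le> j \<Longrightarrow> j \<le> n \<Longrightarrow> h i j \<noteq> 0" and n: "0 \<le> n"
  obtains f where "\<And>j. f 0 j = c0 j" "\<And>j. 1 \<le> j \<Longrightarrow> j \<le> n \<Longrightarrow> f 1 j = c1 j"
    "\<And>i. 1 \<le> i \<Longrightarrow> f i 0 = b i" "\<And>i. 1 \<le> i \<Longrightarrow> f i (n + 1) = 0"
    "\<And>i j. 1 \<le> i \<Longrightarrow> i \<le> m \<Longrightarrow> 1 \<le> j \<Longrightarrow> j \<le> n \<Longrightarrow> net_flow h v f i j = 0"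
proof -
  define f where "f i j = march n h v b c0 c1 (nat i) j" for i j
  have 0: "f 0 j = c0 j" for j by (simp add: f_def)
  have 1: "f 1 j = (if j = 0 then b 1 else if j = n + 1 then 0 else c1 j)" for j
    by (simp add: f_def)
  have S: "f (i + 1) j = (if j = 0 then b (i + 1) else if j = n + 1 then 0 else
      f i j - (h (i - 1) j * (f (i - 1) j - f i j) + v i j * (f i (j + 1) - f i j)
        + v i (j - 1) * (f i (j - 1) - f i j)) / h i j)" if "1 \<le> i" for i j
  proof -
    define k where "k = nat (i - 1)"
    have "i = int (Suc k)" using that by (simp add: k_def)
    then have "nat (i + 1) = Suc (Suc k)" "nat i = Suc k" "nat (i - 1) = k" "int (Suc k) = i" by auto
    then show ?thesis by (simp only: f_def march.simps Let_def)
  qed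
  have 2: "f i 0 = b i" if "1 \<le> i" for i
    using that 1[of 0] S[of "i - 1" 0] by (cases "i = 1") auto
  have 3: "f i (n + 1) = 0" if "1 \<le> i" for i
    using that 1[of "n + 1"] S[of "i - 1" "n + 1"] n by (cases "i = 1") auto
  have 4: "net_flow h v f i j = 0" if "1 \<le> i" "i \<le> m" "1 \<le> j" "j \<le> n" for i j
    using S[of i j] h[OF that] that by (simp add: net_flow_def field_simps)
  have 1: "f 1 j = c1 j" if "1 \<le> j" "j \<le> n" for j using that 1 by simp
  show ?thesis by (rule that[of f]) (fact 0 1 2 3 4)+
qed

section \<open>Reproducing weights do not vanish\<close>

text \<open>
  At the left side a zero weight would suppress the flux of every function.  Let now \<open>1 \<le> i\<close>.  If
  the columns left of \<open>i\<close> have nonzero weights \<open>h'\<close>, any values on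
  the columns \<open>i - 1\<close> and \<open>i\<close> belong to some \<open>h'\<close>-harmonic \<open>x\<close> on the columns up to \<open>i\<close>.  Marching with
  \<open>h\<close> from the Cauchy data of \<open>x\<close> on the left side gives a function \<open>f\<close> on the whole square, and
  the function \<open>f'\<close> that reproduces \<open>f\<close> must be \<open>x\<close> up to column \<open>i\<close>.  The choice of \<open>x\<close> as zero on
  column \<open>i\<close> and as a unit vector on column \<open>i - 1\<close> reduces the equation at \<open>(i, j)\<close> to
  \<open>h' (i - 1) j = 0\<close> if \<open>h' i j = 0\<close>.
\<close>

lemma horizontal_weights_nonzero:
  assumes R: "reproduces n h' v' h v"
    and h: "\<And>i j. 0 \<le> i \<Longrightarrow> i \<le> n \<Longrightarrow> 1 \<le> j \<Longrightarrow> j \<le> n \<Longrightarrow> h i j \<noteq> 0"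
    and "0 \<le> i" "i \<le> n" "1 \<le> j" "j \<le> n"
  shows "h' i j \<noteq> 0"
proof -
  have "\<forall>j. 1 \<le> j \<longrightarrow> j \<le> n \<longrightarrow> h' (int k) j \<noteq> 0" if "int k \<le> n" for k
    using that
  proof (induction k rule: less_induct)
    case (less k)
    define i where "i = int k"
    have i: "0 \<le> i" "i \<le> n" using less.prems by (auto simp: i_def)
    have IH: "h' l j \<noteq> 0" if "0 \<le> l" "l < i" "1 \<le> j" "j \<le> n" for l j
      using less.IH[of "nat l"] that i by (auto simp: i_def)
    show ?case unfolding i_def[symmetric]
    proof (intro allI impI)
      fix j assume j: "1 \<le> j" "j \<le> n"
      show "h' i j \<noteq> 0"
      proof (cases "i = 0")
        case True
        \<comment> \<open>A function with nonzero flux through every edge at the left side.\<close>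
        obtain f where f: "\<And>j. f 0 j = 0" "\<And>j'. 1 \<le> j' \<Longrightarrow> j' \<le> n \<Longrightarrow> f 1 j' = 1"
          "\<And>i. 1 \<le> i \<Longrightarrow> f i 0 = 0" "\<And>i. 1 \<le> i \<Longrightarrow> f i (n + 1) = 0"
          "\<And>i j. 1 \<le> i \<Longrightarrow> i \<le> n \<Longrightarrow> 1 \<le> j \<Longrightarrow> j \<le> n \<Longrightarrow> net_flow h v f i j = 0"
          using march_exists[of n n h "\<lambda>_. 0" "\<lambda>_. 1" "\<lambda>_. 0" v] h j by (smt (verit))
        then have "harmonic n h v f" by (simp add: harmonic_def)
        with R obtain f' where "same_cauchy_data n h v f h' v' f'" unfolding reproduces_def by blast
        from same_cauchy_dataD(2)[OF this j] f(1,2) j h[of 0 j] True show ?thesis by auto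
      next
        case False
        then have i1: "1 \<le> i" using i by simp
        \<comment> \<open>The march starts at column \<open>i\<close> and goes left, so \<open>g k\<close> is column \<open>i - k\<close> of \<open>x\<close>.\<close>
        obtain g where g: "\<And>j. g 0 j = 0" "\<And>j'. 1 \<le> j' \<Longrightarrow> j' \<le> n \<Longrightarrow> g 1 j' = (if j' = j then 1 else 0)"
          "\<And>i. 1 \<le> i \<Longrightarrow> g i 0 = 0" "\<And>i. 1 \<le> i \<Longrightarrow> g i (n + 1) = 0"
          "\<And>k j. 1 \<le> k \<Longrightarrow> k \<le> i - 1 \<Longrightarrow> 1 \<le> j \<Longrightarrow> j \<le> n \<Longrightarrow> net_flow (\<lambda>k. h' (i - 1 - k)) (\<lambda>k. v' (i - k)) g k j = 0"
        proof (rule march_exists[of "i - 1" n "\<lambda>k. h' (i - 1 - k)" "\<lambda>_. 0" "\<lambda>j'. if j' = j then 1 else 0" "\<lambda>_. 0" "\<lambda>k. v' (i - k)"])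
          show "h' (i - 1 - ia) ja \<noteq> 0" if "1 \<le> ia" "ia \<le> i - 1" "1 \<le> ja" "ja \<le> n" for ia ja
            using that IH[of "i - 1 - ia" ja] by simp
        qed (use j in auto)
        define x where "x l = g (i - l)" for l
        have x: "net_flow h' v' x l j = 0" if "1 \<le> l" "l \<le> i - 1" "1 \<le> j" "j \<le> n" for l j
          using g(5)[of "i - l" j] that by (simp add: net_flow_def x_def algebra_simps)
        \<comment> \<open>Column 1 of \<open>f\<close> is chosen so that the fluxes of \<open>f\<close> and \<open>x\<close> through the left side agree.\<close>
        obtain f where f: "\<And>j. f 0 j = x 0 j"
          "\<And>j. 1 \<le> j \<Longrightarrow> j \<le> n \<Longrightarrow> f 1 j = x 0 j + h' 0 j / h 0 j * (x 1 j - x 0 j)"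
          "\<And>i. 1 \<le> i \<Longrightarrow> f i 0 = 0" "\<And>i. 1 \<le> i \<Longrightarrow> f i (n + 1) = 0"
          "\<And>i j. 1 \<le> i \<Longrightarrow> i \<le> n \<Longrightarrow> 1 \<le> j \<Longrightarrow> j \<le> n \<Longrightarrow> net_flow h v f i j = 0"
          by (rule march_exists[of n n h "x 0" "\<lambda>j. x 0 j + h' 0 j / h 0 j * (x 1 j - x 0 j)" "\<lambda>_. 0" v])
            (use h j in auto)
        then have "harmonic n h v f" by (simp add: harmonic_def)
        with R obtain f' where f': "harmonic n h' v' f'" "same_cauchy_data n h v f h' v' f'"
          unfolding reproduces_def by blast
        note D = same_cauchy_dataD[OF f'(2)]
        have bd: "f' l 0 = 0" "f' l (n + 1) = 0" if "1 \<le> l" "l \<le> n" for l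
          using that D(5,7)[of l] f(3,4) by auto
        have xbd: "x l 0 = 0" "x l (n + 1) = 0" if "1 \<le> l" "l \<le> i" for l
          using that g(1,3,4) by (cases "l = i"; simp add: x_def)+
        have eq: "int l \<le> i \<longrightarrow> (\<forall>j. 1 \<le> j \<longrightarrow> j \<le> n \<longrightarrow> f' (int l) j = x (int l) j)" for l
        proof (induction l rule: less_induct)
          case (less l)
          show ?case
          proof (intro impI allI)
            fix j assume l: "int l \<le> i" and j: "1 \<le> j" "j \<le> n"
            consider "l = 0" | "l = 1" | k where "l = Suc k" "1 \<le> k" by (cases l; force)
            then show "f' (int l) j = x (int l) j"
            proof cases
              case 1 then show ?thesis using D(1)[OF j] f(1) by simp
            next
              case 2
              have "h 0 j * (f 0 j - f 1 j) = h' 0 j * (x 0 j - x 1 j)"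
                using f(1) f(2)[OF j] h[of 0 j] j by (simp add: field_simps)
              then have "h' 0 j * (f' 0 j - f' 1 j) = h' 0 j * (x 0 j - x 1 j)"
                using D(2)[OF j] by simp
              then show ?thesis using IH[of 0 j] i1 j D(1)[OF j] f(1) 2 by simp
            next
              case 3
              define p where "p = int k"
              have p: "1 \<le> p" "p \<le> i - 1" "int l = p + 1" using 3 l by (auto simp: p_def)
              have c: "f' p j = x p j" if "0 \<le> j" "j \<le> n + 1" for j
                using less.IH[of k] 3 p l bd[of p] xbd[of p] i that
                by (cases "j = 0"; cases "j = n + 1"; force simp: p_def)
              have c': "f' (p - 1) j = x (p - 1) j"
                using less.IH[of "k - 1"] 3 p l j by (simp add: p_def of_nat_diff)
              have "net_flow h' v' f' p j = net_flow h' v' x p j"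
                using x[of p j] harmonicD[OF f'(1), of p j] p i j by simp
              then show ?thesis
                using c[of j] c[of "j+1"] c[of "j-1"] c' j IH[of p j] p
                by (simp add: net_flow_def)
            qed
          qed
        qed
        have ei: "f' i j' = 0" if "0 \<le> j'" "j' \<le> n + 1" for j'
          using eq[of k] bd[of i] i i1 that g(1)
          by (cases "j' = 0"; cases "j' = n + 1"; force simp: i_def x_def)
        have ei': "f' (i - 1) j = 1"
          using eq[of "k - 1"] j i1 g(2)[OF j] by (simp add: i_def x_def of_nat_diff)
        have "net_flow h' v' f' i j = 0" using harmonicD[OF f'(1) i1 i(2) j] .
        then show ?thesis
          using ei[of j] ei[of "j + 1"] ei[of "j - 1"] ei' j IH[of "i - 1" j] i1
          by (auto simp: net_flow_def)
      qed
    qed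
  qed
  from this[of "nat i"] assms(3-) show ?thesis by simp
qed

section \<open>Recovering the weights on one side of the antidiagonal\<close>

text \<open>
  The value at \<open>(i, j)\<close> is found from the equation at \<open>(i + 1, j)\<close>, and the other four points in this
  equation are at least as far from the corner \<open>(0, 0)\<close>: the region \<open>i + j > t\<close> is closed under
  marching from the right side to the left.
\<close>

lemma vanishing_beyond_antidiagonal:
  assumes H: "harmonic n h v f"
    and h: "\<And>i j. 0 \<le> i \<Longrightarrow> i \<le> n \<Longrightarrow> 1 \<le> j \<Longrightarrow> j \<le> n \<Longrightarrow> h i j \<noteq> 0"
    and right: "\<And>j. 1 \<le> j \<Longrightarrow> j \<le> n \<Longrightarrow> f (n + 1) j = 0 \<and> f n j = 0"
    and top: "\<And>i. 1 \<le> i \<Longrightarrow> i \<le> n \<Longrightarrow> f i (n + 1) = 0"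
    and bottom: "\<And>i. t < i \<Longrightarrow> i \<le> n \<Longrightarrow> f i 0 = 0"
    and ij: "0 \<le> i" "i \<le> n + 1" "0 \<le> j" "j \<le> n + 1" "t < i + j" "1 \<le> i \<and> i \<le> n \<or> 1 \<le> j \<and> j \<le> n"
  shows "f i j = 0"
  using ij
proof (induction "nat (n + 1 - i)" arbitrary: i j rule: less_induct)
  case less
  consider "1 \<le> j" "j \<le> n" "n \<le> i" | "j = 0" "1 \<le> i" "i \<le> n" | "j = n + 1" "1 \<le> i" "i \<le> n"
    | "1 \<le> j" "j \<le> n" "i < n"
    using less.prems by linarith
  then show ?case
  proof cases
    case 1
    then have "i = n \<or> i = n + 1" using less.prems by auto
    then show ?thesis using 1 right[of j] by auto
  next
    case 4
    have z: "f i' j' = 0" if "i < i'" "i' \<le> n + 1" "0 \<le> j'" "j' \<le> n + 1" "t < i' + j'" "i' \<le> n \<or> 1 \<le> j' \<and> j' \<le> n" for i' j'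
      using less.hyps[of i' j'] that less.prems 4 by auto
    have "net_flow h v f (i + 1) j = 0" using harmonicD[OF H, of "i + 1" j] 4 less.prems by simp
    moreover have "f (i + 1) j = 0" "f (i + 1 + 1) j = 0" "f (i + 1) (j + 1) = 0" "f (i + 1) (j - 1) = 0"
      using 4 less.prems by (auto intro!: z)
    ultimately show ?thesis using h[of i j] 4 less.prems by (simp add: net_flow_def)
  qed (use bottom top less.prems in auto)
qed

text \<open>
  March from zero columns at the right side, with the bottom datum concentrated at \<open>(t, 0)\<close>.  At an
  interior point with \<open>i + j = t + 1\<close> only the left and the lower neighbour contribute, so along the
  antidiagonal each value is a nonzero multiple of the previous one, beginning with 1 at \<open>(t, 0)\<close>.
\<close>

lemma antidiagonal_solution:
  assumes h: "\<And>i j. 0 \<le> i \<Longrightarrow> i \<le> n \<Longrightarrow> 1 \<le> j \<Longrightarrow> j \<le> n \<Longrightarrow> h i j \<noteq> 0"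
    and v: "\<And>i j. 1 \<le> i \<Longrightarrow> i \<le> n \<Longrightarrow> 0 \<le> j \<Longrightarrow> j \<le> n \<Longrightarrow> v i j \<noteq> 0"
    and t: "1 \<le> t" "t \<le> n"
  obtains f where "harmonic n h v f"
    "\<And>i j. 0 \<le> i \<Longrightarrow> i \<le> n + 1 \<Longrightarrow> 0 \<le> j \<Longrightarrow> j \<le> n + 1 \<Longrightarrow> t < i + j \<Longrightarrow>
      1 \<le> i \<and> i \<le> n \<or> 1 \<le> j \<and> j \<le> n \<Longrightarrow> f i j = 0"
    "\<And>i. 0 \<le> i \<Longrightarrow> i \<le> t \<Longrightarrow> f i (t - i) \<noteq> 0"
proof -
  obtain g where g: "\<And>j. g 0 j = 0" "\<And>j. 1 \<le> j \<Longrightarrow> j \<le> n \<Longrightarrow> g 1 j = 0"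
    "\<And>k. 1 \<le> k \<Longrightarrow> g k 0 = (if k = n + 1 - t then 1 else 0)" "\<And>k. 1 \<le> k \<Longrightarrow> g k (n + 1) = 0"
    "\<And>k j. 1 \<le> k \<Longrightarrow> k \<le> n \<Longrightarrow> 1 \<le> j \<Longrightarrow> j \<le> n \<Longrightarrow> net_flow (\<lambda>k. h (n - k)) (\<lambda>k. v (n + 1 - k)) g k j = 0"
    by (rule march_exists[of n n "\<lambda>k. h (n - k)" "\<lambda>_. 0" "\<lambda>_. 0" "\<lambda>k. if k = n + 1 - t then 1 else 0" "\<lambda>k. v (n + 1 - k)"])
      (use h t in auto)
  define f where "f i = g (n + 1 - i)" for i
  have "net_flow h v f i j = 0" if "1 \<le> i" "i \<le> n" "1 \<le> j" "j \<le> n" for i j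
    using g(5)[of "n + 1 - i" j] that by (simp add: net_flow_def f_def algebra_simps)
  then have H: "harmonic n h v f" by (simp add: harmonic_def)
  have Z: "f i j = 0" if "0 \<le> i" "i \<le> n + 1" "0 \<le> j" "j \<le> n + 1" "t < i + j" "1 \<le> i \<and> i \<le> n \<or> 1 \<le> j \<and> j \<le> n" for i j
    by (rule vanishing_beyond_antidiagonal[OF H h _ _ _ that]) (use g in \<open>auto simp: f_def\<close>)
  have D: "f i (t - i) \<noteq> 0" if "0 \<le> i" "i \<le> t" for i
    using that
  proof (induction "nat (t - i)" arbitrary: i rule: less_induct)
    case less
    show ?case
    proof (cases "i = t")
      case True then show ?thesis using g(3)[of "n + 1 - t"] t by (simp add: f_def)
    next
      case False
      then have i: "0 \<le> i" "i < t" using less.prems by auto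
      have "f (i + 1) (t - (i + 1)) \<noteq> 0" using less.hyps[of "i + 1"] i by auto
      moreover have "net_flow h v f (i + 1) (t - i) = 0" using harmonicD[OF H, of "i + 1" "t - i"] i t by simp
      moreover have "f (i + 1) (t - i) = 0" "f (i + 1 + 1) (t - i) = 0" "f (i + 1) (t - i + 1) = 0"
        using i t by (auto intro!: Z)
      ultimately show ?thesis using v[of "i + 1" "t - i - 1"] i t by (auto simp: net_flow_def algebra_simps)
    qed
  qed
  show ?thesis by (rule that[of f]) (fact H Z D)+
qed

text \<open>
  Every edge joins two consecutive levels of \<open>i + j\<close>, and the indices of its weight are those of the
  end on the lower level.  The induction step treats the edges between the levels \<open>t\<close> and \<open>t + 1\<close>.
\<close>

lemma weights_below_antidiagonal:
  assumes R: "reproduces n h' v' h v"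
    and h: "\<And>i j. 0 \<le> i \<Longrightarrow> i \<le> n \<Longrightarrow> 1 \<le> j \<Longrightarrow> j \<le> n \<Longrightarrow> h i j \<noteq> 0"
    and v: "\<And>i j. 1 \<le> i \<Longrightarrow> i \<le> n \<Longrightarrow> 0 \<le> j \<Longrightarrow> j \<le> n \<Longrightarrow> v i j \<noteq> 0"
    and t: "t \<le> n"
  shows "(\<forall>i j. 0 \<le> i \<longrightarrow> 1 \<le> j \<longrightarrow> i + j \<le> t \<longrightarrow> h' i j = h i j) \<and>
    (\<forall>i j. 1 \<le> i \<longrightarrow> 0 \<le> j \<longrightarrow> i + j \<le> t \<longrightarrow> v' i j = v i j)"
  using t
proof (induction "nat t" arbitrary: t)
  case 0
  then show ?case by auto
next
  case (Suc k)
  have t: "1 \<le> t" "t \<le> n" using Suc by auto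
  have IH: "(\<forall>i j. 0 \<le> i \<longrightarrow> 1 \<le> j \<longrightarrow> i + j \<le> t - 1 \<longrightarrow> h' i j = h i j) \<and>
    (\<forall>i j. 1 \<le> i \<longrightarrow> 0 \<le> j \<longrightarrow> i + j \<le> t - 1 \<longrightarrow> v' i j = v i j)"
    using Suc.hyps(1)[of "t - 1"] Suc.hyps(2) t by simp
  then have IHh: "h' i j = h i j" if "0 \<le> i" "1 \<le> j" "i + j < t" for i j using that by simp
  from IH have IHv: "v' i j = v i j" if "1 \<le> i" "0 \<le> j" "i + j < t" for i j using that by simp
  note h' = horizontal_weights_nonzero[OF R h]
  obtain f where f: "harmonic n h v f"
    and Z: "\<And>i j. 0 \<le> i \<Longrightarrow> i \<le> n + 1 \<Longrightarrow> 0 \<le> j \<Longrightarrow> j \<le> n + 1 \<Longrightarrow> t < i + j \<Longrightarrow>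
      1 \<le> i \<and> i \<le> n \<or> 1 \<le> j \<and> j \<le> n \<Longrightarrow> f i j = 0"
    and D: "\<And>i. 0 \<le> i \<Longrightarrow> i \<le> t \<Longrightarrow> f i (t - i) \<noteq> 0"
    using antidiagonal_solution[of n h v t] h v t by blast
  obtain x where x: "harmonic n h' v' x" and C: "same_cauchy_data n h v f h' v' x"
    using R f unfolding reproduces_def by blast
  note C = same_cauchy_dataD[OF C]
  have Zx: "x i j = 0" if "0 \<le> i" "i \<le> n + 1" "0 \<le> j" "j \<le> n + 1" "t < i + j" "1 \<le> i \<and> i \<le> n \<or> 1 \<le> j \<and> j \<le> n" for i j
  proof (rule vanishing_beyond_antidiagonal[OF x h' _ _ _ that])
    show "x (n + 1) j = 0 \<and> x n j = 0" if "1 \<le> j" "j \<le> n" for j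
      using C(3,4)[OF that] Z[of "n + 1" j] Z[of n j] h'[of n j] that t by simp
    show "x i (n + 1) = 0" if "1 \<le> i" "i \<le> n" for i
      using C(7)[OF that] Z[of i "n + 1"] that t by simp
    show "x i 0 = 0" if "t < i" "i \<le> n" for i
      using C(5)[of i] Z[of i 0] that t by simp
  qed
  \<comment> \<open>Up to level \<open>t\<close> both functions are found by the same march, as all weights involved agree.\<close>
  have below: "x i j = f i j" if "0 \<le> i" "0 \<le> j" "1 \<le> i + j" "i + j \<le> t" for i j
    using that
  proof (induction "nat i" arbitrary: i j rule: less_induct)
    case less
    consider "j = 0" "1 \<le> i" | "i = 0" "1 \<le> j" | "i = 1" "1 \<le> j" | "2 \<le> i" "1 \<le> j" using less.prems by linarith
    then show ?case
    proof cases
      case 1 then show ?thesis using C(5)[of i] less.prems t by simp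
    next
      case 2 then show ?thesis using C(1)[of j] less.prems t by simp
    next
      case 3
      then show ?thesis using C(1,2)[of j] less.prems t IHh[of 0 j] h[of 0 j] by simp
    next
      case 4
      have "net_flow h' v' x (i - 1) j = net_flow h v f (i - 1) j"
        using harmonicD[OF x, of "i - 1" j] harmonicD[OF f, of "i - 1" j] 4 less.prems t by simp
      moreover have "x (i - 1) j = f (i - 1) j" "x (i - 1 - 1) j = f (i - 1 - 1) j"
        "x (i - 1) (j + 1) = f (i - 1) (j + 1)" "x (i - 1) (j - 1) = f (i - 1) (j - 1)"
        using less.hyps 4 less.prems by auto
      moreover have "h' (i - 1) j = h (i - 1) j" "h' (i - 1 - 1) j = h (i - 1 - 1) j"
        "v' (i - 1) j = v (i - 1) j" "v' (i - 1) (j - 1) = v (i - 1) (j - 1)"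
        using 4 less.prems by (auto intro!: IHh IHv)
      ultimately show ?thesis using h[of "i - 1" j] 4 less.prems t by (simp add: net_flow_def)
    qed
  qed
  \<comment> \<open>The zigzag path from \<open>(0, t)\<close> to \<open>(t, 0)\<close> through the levels \<open>t\<close> and \<open>t + 1\<close>: the flux
    at \<open>(0, t)\<close> gives the first edge; then the equation at \<open>(i, t - i + 1)\<close> gives the edge below
    this point, and the equation at \<open>(i, t - i)\<close> gives the edge to the right of \<open>(i, t - i)\<close>.\<close>
  have zigzag: "(i < t \<longrightarrow> h' i (t - i) = h i (t - i)) \<and> (1 \<le> i \<longrightarrow> v' i (t - i) = v i (t - i))"
    if "0 \<le> i" "i \<le> t" for i
    using that
  proof (induction "nat i" arbitrary: i)
    case 0
    then have "i = 0" by simp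
    moreover have "x 1 t = 0" "f 1 t = 0" using Z[of 1 t] Zx[of 1 t] t by auto
    ultimately show ?case using C(1,2)[of t] D[of 0] t by simp
  next
    case (Suc k)
    then have i: "1 \<le> i" "i \<le> t" by auto
    have hl: "h' (i - 1) (t - i + 1) = h (i - 1) (t - i + 1)"
      using Suc.hyps(1)[of "i - 1"] Suc.hyps(2) i by (simp add: algebra_simps)
    have z: "x i (t - i + 1) = 0" "x (i + 1) (t - i + 1) = 0" "x i (t - i + 1 + 1) = 0"
      "f i (t - i + 1) = 0" "f (i + 1) (t - i + 1) = 0" "f i (t - i + 1 + 1) = 0"
      using i t by (auto intro!: Z Zx)
    have e: "x (i - 1) (t - i + 1) = f (i - 1) (t - i + 1)" "x i (t - i) = f i (t - i)"
      using i by (auto intro!: below)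
    have "net_flow h' v' x i (t - i + 1) = net_flow h v f i (t - i + 1)"
      using harmonicD[OF x, of i "t - i + 1"] harmonicD[OF f, of i "t - i + 1"] i t by simp
    then have V: "v' i (t - i) = v i (t - i)"
      using z hl e D[of i] i by (simp add: net_flow_def)
    moreover have "h' i (t - i) = h i (t - i)" if "i < t"
    proof -
      have "net_flow h' v' x i (t - i) = net_flow h v f i (t - i)"
        using harmonicD[OF x, of i "t - i"] harmonicD[OF f, of i "t - i"] i t that by simp
      moreover have "x (i - 1) (t - i) = f (i - 1) (t - i)" "x i (t - i - 1) = f i (t - i - 1)"
        using i that by (auto intro!: below)
      moreover have "x (i + 1) (t - i) = 0" "f (i + 1) (t - i) = 0"
        using i t that by (auto intro!: Z Zx)
      moreover have "h' (i - 1) (t - i) = h (i - 1) (t - i)" "v' i (t - i - 1) = v i (t - i - 1)"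
        using i that by (auto intro!: IHh IHv)
      ultimately show ?thesis using z V e D[of i] i by (simp add: net_flow_def)
    qed
    ultimately show ?case by simp
  qed
  show ?case
  proof (intro conjI allI impI)
    fix i j :: int assume a: "0 \<le> i" "1 \<le> j" "i + j \<le> t"
    show "h' i j = h i j"
    proof (cases "i + j = t")
      case True
      then have "j = t - i" by simp
      then show ?thesis using zigzag[of i] a by simp
    qed (use IHh a in auto)
  next
    fix i j :: int assume a: "1 \<le> i" "0 \<le> j" "i + j \<le> t"
    show "v' i j = v i j"
    proof (cases "i + j = t")
      case True
      then have "j = t - i" by simp
      then show ?thesis using zigzag[of i] a by simp
    qed (use IHv a in auto)
  qed
qed

text \<open>
  The main antidiagonal \<open>i + j = n + 1\<close> is crossed by no edge, so each edge lies in one of the two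
  triangles, and these are exchanged by the half turn.
\<close>

lemma reproducing_weights_unique:
  assumes R: "reproduces n h' v' h v"
    and h: "\<And>i j. 0 \<le> i \<Longrightarrow> i \<le> n \<Longrightarrow> 1 \<le> j \<Longrightarrow> j \<le> n \<Longrightarrow> h i j \<noteq> 0"
    and v: "\<And>i j. 1 \<le> i \<Longrightarrow> i \<le> n \<Longrightarrow> 0 \<le> j \<Longrightarrow> j \<le> n \<Longrightarrow> v i j \<noteq> 0"
  shows "\<And>i j. 0 \<le> i \<Longrightarrow> i \<le> n \<Longrightarrow> 1 \<le> j \<Longrightarrow> j \<le> n \<Longrightarrow> h' i j = h i j"
    and "\<And>i j. 1 \<le> i \<Longrightarrow> i \<le> n \<Longrightarrow> 0 \<le> j \<Longrightarrow> j \<le> n \<Longrightarrow> v' i j = v i j"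
proof -
  note A = weights_below_antidiagonal[OF R h v order_refl]
  note B = weights_below_antidiagonal[OF reproduces_rotate[OF R] _ _ order_refl]
  have B: "(\<forall>i j. 0 \<le> i \<longrightarrow> 1 \<le> j \<longrightarrow> i + j \<le> n \<longrightarrow> h' (n - i) (n + 1 - j) = h (n - i) (n + 1 - j)) \<and>
    (\<forall>i j. 1 \<le> i \<longrightarrow> 0 \<le> j \<longrightarrow> i + j \<le> n \<longrightarrow> v' (n + 1 - i) (n - j) = v (n + 1 - i) (n - j))"
    by (rule B) (simp_all add: h v)
  fix i j :: int
  show "h' i j = h i j" if "0 \<le> i" "i \<le> n" "1 \<le> j" "j \<le> n"
  proof (cases "i + j \<le> n")
    case False
    then show ?thesis using B[THEN conjunct1, rule_format, of "n - i" "n + 1 - j"] that by simp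
  qed (use A that in auto)
  show "v' i j = v i j" if "1 \<le> i" "i \<le> n" "0 \<le> j" "j \<le> n"
  proof (cases "i + j \<le> n")
    case False
    then show ?thesis using B[THEN conjunct2, rule_format, of "n + 1 - i" "n - j"] that by simp
  qed (use A that in auto)
qed


section \<open>Uniqueness for the Dirichlet problem\<close>

text \<open>
  A positive maximum at a point of \<open>{1..n} \<times> {1..n}\<close> is also attained at the left neighbour, hence by
  repetition on the left side, where the function is zero.
\<close>

lemma harmonic_zero_boundary_nonpos:
  assumes H: "harmonic n h v f"
    and h: "\<And>i j. 0 \<le> i \<Longrightarrow> i \<le> n \<Longrightarrow> 1 \<le> j \<Longrightarrow> j \<le> n \<Longrightarrow> h i j > 0"
    and v: "\<And>i j. 1 \<le> i \<Longrightarrow> i \<le> n \<Longrightarrow> 0 \<le> j \<Longrightarrow> j \<le> n \<Longrightarrow> v i j > 0"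
    and bd: "\<And>k. 1 \<le> k \<Longrightarrow> k \<le> n \<Longrightarrow> f 0 k = 0 \<and> f (n + 1) k = 0 \<and> f k 0 = 0 \<and> f k (n + 1) = 0"
    and ij: "1 \<le> i" "i \<le> n" "1 \<le> j" "j \<le> n"
  shows "f i j \<le> 0"
proof (rule ccontr)
  define A where "A = (\<lambda>(i, j). f i j) ` ({1..n} \<times> {1..n})"
  define M where "M = Max A"
  have A: "finite A" "f i j \<in> A" using ij by (auto simp: A_def)
  have le: "f i j \<le> M" if "1 \<le> i" "i \<le> n" "1 \<le> j" "j \<le> n" for i j
    unfolding M_def using that by (intro Max_ge) (auto simp: A_def)
  assume "\<not> f i j \<le> 0"
  then have M: "M > 0" using le[OF ij] by simp
  have le': "f i j \<le> M" if r: "0 \<le> i" "i \<le> n + 1" "0 \<le> j" "j \<le> n + 1" "1 \<le> i \<and> i \<le> n \<or> 1 \<le> j \<and> j \<le> n" for i j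
  proof -
    consider "1 \<le> i" "i \<le> n" "1 \<le> j" "j \<le> n" | "i = 0" "1 \<le> j" "j \<le> n" | "i = n + 1" "1 \<le> j" "j \<le> n"
      | "j = 0" "1 \<le> i" "i \<le> n" | "j = n + 1" "1 \<le> i" "i \<le> n"
      using r by linarith
    then show ?thesis by cases (use le[of i j] bd[of i] bd[of j] M in auto)
  qed
  have "f i j \<noteq> M" if "0 \<le> i" "i \<le> n" "1 \<le> j" "j \<le> n" for i j
    using that
  proof (induction "nat i" arbitrary: i)
    case 0
    then show ?case using bd[of j] M by simp
  next
    case (Suc k)
    show ?case
    proof
      assume m: "f i j = M"
      have i: "1 \<le> i" using Suc.hyps(2) by linarith
      have "f (i - 1) j \<noteq> M" using Suc.hyps(1)[of "i - 1"] Suc.hyps(2) Suc.prems i by simp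
      then have "f (i - 1) j < M" using le'[of "i - 1" j] Suc.prems i by simp
      then have "h (i - 1) j * (f (i - 1) j - f i j) < 0"
        using h[of "i - 1" j] Suc.prems i m by (simp add: mult_pos_neg)
      moreover have "h i j * (f (i + 1) j - f i j) \<le> 0" "v i j * (f i (j + 1) - f i j) \<le> 0"
        "v i (j - 1) * (f i (j - 1) - f i j) \<le> 0"
        using h[of i j] v[of i j] v[of i "j - 1"] le'[of "i + 1" j] le'[of i "j + 1"] le'[of i "j - 1"]
          Suc.prems i m by (auto intro!: mult_nonneg_nonpos)
      ultimately have "net_flow h v f i j < 0" unfolding net_flow_def by linarith
      then show False using harmonicD[OF H i, of j] Suc.prems by simp
    qed
  qed
  moreover have "M \<in> A" unfolding M_def using A by (intro Max_in) auto
  then obtain i j where "1 \<le> i" "i \<le> n" "1 \<le> j" "j \<le> n" "f i j = M" by (auto simp: A_def)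
  ultimately show False by (metis order_trans zero_le_one)
qed

section \<open>Lattice vectors in coordinates\<close>

definition hor :: "(point set \<Rightarrow> real) \<Rightarrow> grid_fun"
  where "hor W i j = W {(i, j), (i + 1, j)}"

definition ver :: "(point set \<Rightarrow> real) \<Rightarrow> grid_fun"
  where "ver W i j = W {(i, j), (i, j + 1)}"

lemma sum_nbrs_eq_net_flow:
  assumes "(i, j) \<in> interior_pts n"
  shows "(\<Sum>q\<in>nbrs n (i, j). W {q, (i, j)} * (u q - u (i, j))) =
    net_flow (hor W) (ver W) (\<lambda>i j. u (i, j)) i j"
  unfolding nbrs_interior[OF assms]
  by (simp add: net_flow_def hor_def ver_def insert_commute)

lemma bnbr_eqI: "q \<in> boundary_pts n \<Longrightarrow> p \<in> nbrs n q \<Longrightarrow> bnbr n q = p"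
  using nbrs_boundary(1)[of q n] by auto

lemma bnbr_sides:
  assumes "1 \<le> k" "k \<le> int n"
  shows "bnbr n (0, k) = (1, k)" "bnbr n (int n + 1, k) = (int n, k)"
    "bnbr n (k, 0) = (k, 1)" "bnbr n (k, int n + 1) = (k, int n)"
  using assms
  by (auto intro!: bnbr_eqI simp: mem_nbrs_iff boundary_pts_def interior_pts_def closure_pts_def)

lemma boundary_cases:
  assumes "q \<in> boundary_pts n"
  obtains k where "1 \<le> k" "k \<le> int n" "q \<in> {(0, k), (int n + 1, k), (k, 0), (k, int n + 1)}"
  using assms by (auto simp: boundary_pts_def)

lemma edge_cases:
  assumes "e \<in> edges n"
  obtains i j where "0 \<le> i" "i \<le> int n" "1 \<le> j" "j \<le> int n" "e = {(i, j), (i + 1, j)}"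
  | i j where "1 \<le> i" "i \<le> int n" "0 \<le> j" "j \<le> int n" "e = {(i, j), (i, j + 1)}"
proof -
  obtain p q where e: "e = {p, q}" "q \<in> nbrs n p" "p \<in> interior_pts n"
  proof -
    from assms obtain p q where pq: "e = {p, q}" "p \<in> interior_pts n \<or> q \<in> interior_pts n"
      by (auto simp: edges_def)
    then have "q \<in> nbrs n p" "p \<in> nbrs n q" using assms by (auto simp: nbrs_def insert_commute)
    with pq that show ?thesis by (metis insert_commute)
  qed
  obtain i j where p: "p = (i, j)" by (cases p)
  have ij: "1 \<le> i" "i \<le> int n" "1 \<le> j" "j \<le> int n" using e(3) by (auto simp: p interior_pts_def)
  have "q \<in> {(i - 1, j), (i + 1, j), (i, j - 1), (i, j + 1)}"
    using e(2,3) nbrs_interior[of i j n] by (simp add: p)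
  then consider "q = (i - 1, j)" | "q = (i + 1, j)" | "q = (i, j - 1)" | "q = (i, j + 1)" by auto
  then show ?thesis
  proof cases
    case 1 then show ?thesis using that(1)[of "i - 1" j] ij by (simp add: e p insert_commute)
  next
    case 2 then show ?thesis using that(1)[of i j] ij by (simp add: e p)
  next
    case 3 then show ?thesis using that(2)[of i "j - 1"] ij by (simp add: e p insert_commute)
  next
    case 4 then show ?thesis using that(2)[of i j] ij by (simp add: e p)
  qed
qed

lemma hor_edge: "0 \<le> i \<Longrightarrow> i \<le> int n \<Longrightarrow> 1 \<le> j \<Longrightarrow> j \<le> int n \<Longrightarrow> {(i, j), (i + 1, j)} \<in> edges n"
  by (auto simp: edge_iff_nbrs mem_nbrs_iff interior_pts_def boundary_pts_def closure_pts_def)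

lemma ver_edge: "1 \<le> i \<Longrightarrow> i \<le> int n \<Longrightarrow> 0 \<le> j \<Longrightarrow> j \<le> int n \<Longrightarrow> {(i, j), (i, j + 1)} \<in> edges n"
  by (auto simp: edge_iff_nbrs mem_nbrs_iff interior_pts_def boundary_pts_def closure_pts_def)

lemma conductivity_positive:
  assumes "conductivity_profile n \<gamma>"
  shows "0 \<le> i \<Longrightarrow> i \<le> int n \<Longrightarrow> 1 \<le> j \<Longrightarrow> j \<le> int n \<Longrightarrow> hor \<gamma> i j > 0"
    and "1 \<le> i \<Longrightarrow> i \<le> int n \<Longrightarrow> 0 \<le> j \<Longrightarrow> j \<le> int n \<Longrightarrow> ver \<gamma> i j > 0"
  using assms hor_edge ver_edge by (auto simp: conductivity_profile_def hor_def ver_def)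

lemma finite_pts: "finite (boundary_pts n)" "finite (interior_pts n)"
  by (auto simp: boundary_pts_def interior_pts_def)

lemma dirichlet_harmonic:
  assumes "dirichlet_solution n \<gamma> ub u"
  shows "harmonic (int n) (hor \<gamma>) (ver \<gamma>) (\<lambda>i j. u (i, j))"
  unfolding harmonic_def
proof (intro ballI)
  fix i j assume "i \<in> {1..int n}" "j \<in> {1..int n}"
  then have p: "(i, j) \<in> interior_pts n" by (simp add: interior_pts_def)
  then show "net_flow (hor \<gamma>) (ver \<gamma>) (\<lambda>i j. u (i, j)) i j = 0"
    using assms sum_nbrs_eq_net_flow[OF p, of \<gamma> u] by (simp add: dirichlet_solution_def)
qed

lemma dirichlet_le:
  assumes g: "conductivity_profile n \<gamma>"
    and u: "dirichlet_solution n \<gamma> ub u" "dirichlet_solution n \<gamma> ub u'"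
    and p: "p \<in> interior_pts n"
  shows "u p \<le> u' p"
proof -
  obtain i j where ij: "p = (i, j)" by (cases p)
  have "harmonic (int n) (hor \<gamma>) (ver \<gamma>) (\<lambda>i j. u (i, j) - u' (i, j))"
    using u[THEN dirichlet_harmonic] by (simp add: harmonic_def net_flow_diff)
  moreover have "u q = u' q" if "q \<in> boundary_pts n" for q
    using u that by (simp add: dirichlet_solution_def)
  then have "u (0, k) - u' (0, k) = 0 \<and> u (int n + 1, k) - u' (int n + 1, k) = 0 \<and>
      u (k, 0) - u' (k, 0) = 0 \<and> u (k, int n + 1) - u' (k, int n + 1) = 0"
    if "1 \<le> k" "k \<le> int n" for k
    using that by (simp add: boundary_pts_def)
  moreover have "1 \<le> i" "i \<le> int n" "1 \<le> j" "j \<le> int n"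
    using p by (auto simp: ij interior_pts_def)
  ultimately have "u (i, j) - u' (i, j) \<le> 0"
    using conductivity_positive[OF g]
    by (intro harmonic_zero_boundary_nonpos[where n = "int n" and h = "hor \<gamma>" and v = "ver \<gamma>"
          and f = "\<lambda>i j. u (i, j) - u' (i, j)" and i = i and j = j]) simp_all
  then show ?thesis by (simp add: ij)
qed

lemma dirichlet_unique:
  assumes g: "conductivity_profile n \<gamma>"
    and u: "dirichlet_solution n \<gamma> ub u" "dirichlet_solution n \<gamma> ub u'"
  shows "u = u'"
proof
  fix p
  consider "p \<in> interior_pts n" | "p \<in> boundary_pts n" | "p \<notin> closure_pts n"
    by (auto simp: closure_pts_def)
  then show "u p = u' p"
  proof cases
    case 1
    then show ?thesis using dirichlet_le[OF g] u by (meson order_antisym)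
  next
    case 2
    then show ?thesis using u by (simp add: dirichlet_solution_def)
  next
    case 3
    have "u \<in> vecs (closure_pts n)" "u' \<in> vecs (closure_pts n)" using u by (auto simp: dirichlet_solution_def)
    with 3 have "u p = 0" "u' p = 0" unfolding vecs_def by blast+
    then show ?thesis by simp
  qed
qed

section \<open>Linearity in the Dirichlet datum\<close>

lemma dirichlet_zero: "dirichlet_solution n \<gamma> (\<lambda>_. 0) (\<lambda>_. 0)"
  by (simp add: dirichlet_solution_def vecs_def)

lemma dirichlet_add:
  assumes "dirichlet_solution n \<gamma> a u" "dirichlet_solution n \<gamma> b w"
  shows "dirichlet_solution n \<gamma> (\<lambda>x. a x + b x) (\<lambda>x. u x + w x)"
proof -
  have "(\<Sum>q\<in>nbrs n p. \<gamma> {q, p} * (u q + w q - (u p + w p))) =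
    (\<Sum>q\<in>nbrs n p. \<gamma> {q, p} * (u q - u p)) + (\<Sum>q\<in>nbrs n p. \<gamma> {q, p} * (w q - w p))" for p
    by (simp add: sum.distrib[symmetric] algebra_simps)
  then show ?thesis using assms by (simp add: dirichlet_solution_def vecs_def)
qed

lemma dirichlet_scale:
  assumes "dirichlet_solution n \<gamma> a u"
  shows "dirichlet_solution n \<gamma> (\<lambda>x. c * a x) (\<lambda>x. c * u x)"
proof -
  have "(\<Sum>q\<in>nbrs n p. \<gamma> {q, p} * (c * u q - c * u p)) = c * (\<Sum>q\<in>nbrs n p. \<gamma> {q, p} * (u q - u p))" for p
    by (simp add: sum_distrib_left algebra_simps)
  then show ?thesis using assms by (simp add: dirichlet_solution_def vecs_def)
qed

lemma dirichlet_sum: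
  assumes "finite A" "\<And>k. k \<in> A \<Longrightarrow> dirichlet_solution n \<gamma> (a k) (u k)"
  shows "dirichlet_solution n \<gamma> (\<lambda>x. \<Sum>k\<in>A. c k * a k x) (\<lambda>x. \<Sum>k\<in>A. c k * u k x)"
  using assms
proof (induction A rule: finite_induct)
  case empty
  then show ?case by (simp add: dirichlet_zero)
next
  case (insert k A)
  have "dirichlet_solution n \<gamma> (\<lambda>x. c k * a k x + (\<Sum>k\<in>A. c k * a k x)) (\<lambda>x. c k * u k x + (\<Sum>k\<in>A. c k * u k x))"
    by (rule dirichlet_add[OF dirichlet_scale]) (use insert in auto)
  then show ?case using insert.hyps by simp
qed

text \<open>
  The output of \<open>W\<close> vanishes on the Cauchy pair of \<open>\<gamma>\<close> with Dirichlet datum \<open>ub\<close>.  Quantifying over the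
  solution inside makes this a property of the datum alone, so that its extent is a linear subspace.
\<close>

definition fits :: "nat \<Rightarrow> (point set \<Rightarrow> real) \<Rightarrow> params \<Rightarrow> (point \<Rightarrow> real) \<Rightarrow> bool"
  where "fits n \<gamma> W ub \<longleftrightarrow> (\<exists>u. dirichlet_solution n \<gamma> ub u \<and>
    (\<forall>r\<in>closure_pts n. network_output n W ub (\<lambda>q. \<gamma> {q, bnbr n q} * (u q - u (bnbr n q))) r = 0))"

lemma hidden_tilde_add: "hidden_tilde n W1 (\<lambda>x. a x + b x) r = hidden_tilde n W1 a r + hidden_tilde n W1 b r"
  by (simp add: hidden_tilde_def sum.distrib[symmetric] algebra_simps)

lemma hidden_tilde_scale: "hidden_tilde n W1 (\<lambda>x. c * a x) r = c * hidden_tilde n W1 a r"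
  by (simp add: hidden_tilde_def sum_distrib_left algebra_simps)

lemma network_output_interior:
  "r \<in> interior_pts n \<Longrightarrow> network_output n W a y r =
    (\<Sum>p\<in>nbrs n r. snd W {p, r} * (hidden_tilde n (fst W) a p - hidden_tilde n (fst W) a r))"
  by (simp add: network_output_def second_layer_def)

lemma network_output_boundary:
  "r \<in> boundary_pts n \<Longrightarrow> network_output n W a y r =
    snd W {bnbr n r, r} * (hidden_tilde n (fst W) a r - hidden_tilde n (fst W) a (bnbr n r)) - y r"
  using interior_boundary_disjoint[of n]
  by (auto simp: network_output_def second_layer_def hidden_hat_def)

lemma network_output_add:
  "network_output n W (\<lambda>x. a x + b x) (\<lambda>x. y x + z x) r = network_output n W a y r + network_output n W b z r"
proof -
  have "(\<Sum>p\<in>nbrs n r. snd W {p, r} * (u p + w p - (u r + w r))) =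
    (\<Sum>p\<in>nbrs n r. snd W {p, r} * (u p - u r)) + (\<Sum>p\<in>nbrs n r. snd W {p, r} * (w p - w r))" for u w
    by (simp add: sum.distrib[symmetric] algebra_simps)
  moreover have "c * (u + w - (u' + w')) - (y' + z') = (c * (u - u') - y') + (c * (w - w') - z')"
    for c u w u' w' y' z' :: real
    by (simp add: algebra_simps)
  ultimately show ?thesis
    by (simp add: network_output_def second_layer_def hidden_hat_def hidden_tilde_add)
qed

lemma network_output_scale:
  "network_output n W (\<lambda>x. c * a x) (\<lambda>x. c * y x) r = c * network_output n W a y r"
proof -
  have "(\<Sum>p\<in>nbrs n r. snd W {p, r} * (c * u p - c * u r)) =
    c * (\<Sum>p\<in>nbrs n r. snd W {p, r} * (u p - u r))" for u
    by (simp add: sum_distrib_left algebra_simps)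
  moreover have "w * (c * u - c * u') - c * y' = c * (w * (u - u') - y')" for w u u' y' :: real
    by (simp add: algebra_simps)
  ultimately show ?thesis
    by (simp add: network_output_def second_layer_def hidden_hat_def hidden_tilde_scale)
qed

lemma fits_zero: "fits n \<gamma> W (\<lambda>_. 0)"
proof -
  have "network_output n W (\<lambda>_. 0) (\<lambda>q. \<gamma> {q, bnbr n q} * (0 - 0)) r = 0" for r
    using network_output_scale[of n W 0 "\<lambda>_. 0" "\<lambda>_. 0" r] by simp
  then show ?thesis unfolding fits_def using dirichlet_zero[of n \<gamma>] by blast
qed

lemma fits_add:
  assumes "fits n \<gamma> W a" "fits n \<gamma> W b"
  shows "fits n \<gamma> W (\<lambda>x. a x + b x)"
proof -
  obtain u w where u: "dirichlet_solution n \<gamma> a u" "dirichlet_solution n \<gamma> b w"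
    "\<forall>r\<in>closure_pts n. network_output n W a (\<lambda>q. \<gamma> {q, bnbr n q} * (u q - u (bnbr n q))) r = 0"
    "\<forall>r\<in>closure_pts n. network_output n W b (\<lambda>q. \<gamma> {q, bnbr n q} * (w q - w (bnbr n q))) r = 0"
    using assms unfolding fits_def by blast
  have "(\<lambda>q. \<gamma> {q, bnbr n q} * ((u q + w q) - (u (bnbr n q) + w (bnbr n q)))) =
    (\<lambda>q. \<gamma> {q, bnbr n q} * (u q - u (bnbr n q)) + \<gamma> {q, bnbr n q} * (w q - w (bnbr n q)))"
    by (simp add: algebra_simps)
  then have "\<forall>r\<in>closure_pts n. network_output n W (\<lambda>x. a x + b x)
      (\<lambda>q. \<gamma> {q, bnbr n q} * ((u q + w q) - (u (bnbr n q) + w (bnbr n q)))) r = 0"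
    using u(3,4) by (simp only: network_output_add) simp
  with dirichlet_add[OF u(1,2)] show ?thesis unfolding fits_def by (intro exI conjI)
qed

lemma fits_scale:
  assumes "fits n \<gamma> W a"
  shows "fits n \<gamma> W (\<lambda>x. c * a x)"
proof -
  obtain u where u: "dirichlet_solution n \<gamma> a u"
    "\<forall>r\<in>closure_pts n. network_output n W a (\<lambda>q. \<gamma> {q, bnbr n q} * (u q - u (bnbr n q))) r = 0"
    using assms unfolding fits_def by blast
  have "(\<lambda>q. \<gamma> {q, bnbr n q} * (c * u q - c * u (bnbr n q))) =
    (\<lambda>q. c * (\<gamma> {q, bnbr n q} * (u q - u (bnbr n q))))"
    by (simp add: algebra_simps)
  then have "\<forall>r\<in>closure_pts n. network_output n W (\<lambda>x. c * a x)
      (\<lambda>q. \<gamma> {q, bnbr n q} * (c * u q - c * u (bnbr n q))) r = 0"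
    using u(2) by (simp only: network_output_scale) simp
  with dirichlet_scale[OF u(1)] show ?thesis unfolding fits_def by (intro exI conjI)
qed

lemma subspace_fits: "module.subspace fscale {ub. fits n \<gamma> W ub}"
  unfolding module.subspace_def[OF module_fscale] zero_fun_def plus_fun_def fscale_def mem_Collect_eq
proof (intro conjI ballI allI)
  show "fits n \<gamma> W (\<lambda>_. 0)" by (rule fits_zero)
  show "fits n \<gamma> W (\<lambda>x. a x + b x)" if "a \<in> {ub. fits n \<gamma> W ub}" "b \<in> {ub. fits n \<gamma> W ub}" for a b
    using that by (intro fits_add) simp_all
  show "fits n \<gamma> W (\<lambda>x. c * a x)" if "a \<in> {ub. fits n \<gamma> W ub}" for c a
    using that by (intro fits_scale) simp
qed

lemma subspace_dirichlet: "module.subspace fscale {ub. \<exists>u. dirichlet_solution n \<gamma> ub u}"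
  unfolding module.subspace_def[OF module_fscale] zero_fun_def plus_fun_def fscale_def mem_Collect_eq
proof (intro conjI ballI allI)
  show "\<exists>u. dirichlet_solution n \<gamma> (\<lambda>_. 0) u" by (rule exI, rule dirichlet_zero)
next
  fix a b assume "a \<in> {ub. \<exists>u. dirichlet_solution n \<gamma> ub u}" "b \<in> {ub. \<exists>u. dirichlet_solution n \<gamma> ub u}"
  then obtain u w where "dirichlet_solution n \<gamma> a u" "dirichlet_solution n \<gamma> b w" by blast
  from dirichlet_add[OF this] show "\<exists>u. dirichlet_solution n \<gamma> (\<lambda>x. a x + b x) u"
    by (rule exI[of _ "\<lambda>x. u x + w x"])
next
  fix c a assume "a \<in> {ub. \<exists>u. dirichlet_solution n \<gamma> ub u}"
  then obtain u where "dirichlet_solution n \<gamma> a u" by blast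
  from dirichlet_scale[OF this] show "\<exists>u. dirichlet_solution n \<gamma> (\<lambda>x. c * a x) u"
    by (rule exI[of _ "\<lambda>x. c * u x"])
qed

text \<open>
  This transfers a property from the given data to all data: with the two subspaces above it gives
  solvability of the Dirichlet problem and vanishing output for every boundary datum.
\<close>

lemma basis_in_subspace:
  assumes "basis_of_vecs A S" "S \<subseteq> V" "module.subspace fscale V"
  shows "vecs A \<subseteq> V"
  using module.span_minimal[OF module_fscale assms(2,3)] assms(1) by (simp add: basis_of_vecs_def)

lemma network_output_cong:
  assumes "\<And>q. q \<in> boundary_pts n \<Longrightarrow> y q = z q"
  shows "network_output n W xt y r = network_output n W xt z r"
  using assms by (simp add: network_output_def second_layer_def hidden_hat_def)

section \<open>Vanishing loss\<close>

lemma loss_nonneg: "\<alpha> > 0 \<Longrightarrow> loss n \<alpha> m d W \<ge> 0"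
  unfolding loss_def by (intro mult_nonneg_nonneg sum_nonneg add_nonneg_nonneg) auto

lemma loss_zero_iff:
  assumes "\<alpha> > 0" "m \<ge> 1"
  shows "loss n \<alpha> m d W = 0 \<longleftrightarrow>
    (\<forall>k\<in>{1..m}. \<forall>r\<in>closure_pts n. network_output n W (fst (d k)) (snd (d k)) r = 0)"
proof -
  have "loss n \<alpha> m d W = 0 \<longleftrightarrow> (\<forall>k\<in>{1..m}.
      (\<Sum>p\<in>boundary_pts n. (network_output n W (fst (d k)) (snd (d k)) p)\<^sup>2) +
        \<alpha> * (\<Sum>p\<in>interior_pts n. (network_output n W (fst (d k)) (snd (d k)) p)\<^sup>2) = 0)"
    using assms unfolding loss_def
    by (subst mult_eq_0_iff, subst sum_nonneg_eq_0_iff)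
      (auto intro!: add_nonneg_nonneg mult_nonneg_nonneg sum_nonneg)
  also have "\<dots> \<longleftrightarrow> (\<forall>k\<in>{1..m}. \<forall>r\<in>closure_pts n. network_output n W (fst (d k)) (snd (d k)) r = 0)"
    using assms
    by (subst add_nonneg_eq_0_iff)
      (auto simp: sum_nonneg_eq_0_iff finite_pts closure_pts_def intro!: mult_nonneg_nonneg sum_nonneg)
  finally show ?thesis .
qed

text \<open>
  The reproducing function is the hidden layer for the boundary values of \<open>f\<close>; it has the right fluxes
  because \<open>f\<close> is the only solution for these values.
\<close>

lemma hidden_layer_reproduces:
  assumes g: "conductivity_profile n \<gamma>"
    and fit: "\<And>ub. ub \<in> vecs (boundary_pts n) \<Longrightarrow> fits n \<gamma> W ub"
  shows "reproduces (int n) (hor (snd W)) (ver (snd W)) (hor \<gamma>) (ver \<gamma>)"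
  unfolding reproduces_def
proof (intro allI impI)
  fix f assume f: "harmonic (int n) (hor \<gamma>) (ver \<gamma>) f"
  define w where "w p = (if p \<in> closure_pts n then f (fst p) (snd p) else 0)" for p
  define ub where "ub p = (if p \<in> boundary_pts n then w p else 0)" for p
  have w: "w (i, j) = f i j" if "0 \<le> i" "i \<le> int n + 1" "0 \<le> j" "j \<le> int n + 1"
    "1 \<le> i \<and> i \<le> int n \<or> 1 \<le> j \<and> j \<le> int n" for i j
    using that by (auto simp: w_def closure_pts_def interior_pts_def boundary_pts_def)
  have "dirichlet_solution n \<gamma> ub w"
    unfolding dirichlet_solution_def
  proof (intro conjI ballI)
    fix p assume p: "p \<in> interior_pts n"
    obtain i j where ij: "p = (i, j)" by (cases p)
    have "net_flow (hor \<gamma>) (ver \<gamma>) (\<lambda>i j. w (i, j)) i j = net_flow (hor \<gamma>) (ver \<gamma>) f i j"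
      using p by (simp add: net_flow_def w ij interior_pts_def)
    then show "(\<Sum>q\<in>nbrs n p. \<gamma> {q, p} * (w q - w p)) = 0"
      using sum_nbrs_eq_net_flow[of i j n \<gamma> w] p harmonicD[OF f, of i j] by (simp add: ij interior_pts_def)
  qed (auto simp: vecs_def w_def ub_def)
  moreover have "ub \<in> vecs (boundary_pts n)" by (simp add: ub_def vecs_def)
  ultimately have out: "network_output n W ub (\<lambda>q. \<gamma> {q, bnbr n q} * (w q - w (bnbr n q))) r = 0"
    if "r \<in> closure_pts n" for r
    using fit[of ub] dirichlet_unique[OF g] that unfolding fits_def by blast
  define x where "x = hidden_tilde n (fst W) ub"
  have "harmonic (int n) (hor (snd W)) (ver (snd W)) (\<lambda>i j. x (i, j))"
    unfolding harmonic_def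
  proof (intro ballI)
    fix i j assume "i \<in> {1..int n}" "j \<in> {1..int n}"
    then have p: "(i, j) \<in> interior_pts n" by (simp add: interior_pts_def)
    show "net_flow (hor (snd W)) (ver (snd W)) (\<lambda>i j. x (i, j)) i j = 0"
      using out[of "(i, j)"] p sum_nbrs_eq_net_flow[OF p, of "snd W" x]
      by (simp add: network_output_interior x_def closure_pts_def)
  qed
  moreover have xb: "x q = w q" if "q \<in> boundary_pts n" for q
    using that by (simp add: x_def hidden_tilde_def ub_def)
  have fl: "snd W {bnbr n q, q} * (x q - x (bnbr n q)) = \<gamma> {bnbr n q, q} * (w q - w (bnbr n q))"
    if "q \<in> boundary_pts n" for q
    using out[of q] that by (simp add: network_output_boundary x_def closure_pts_def insert_commute)
  have "same_cauchy_data (int n) (hor \<gamma>) (ver \<gamma>) f (hor (snd W)) (ver (snd W)) (\<lambda>i j. x (i, j))"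
    unfolding same_cauchy_data_def
  proof (intro ballI)
    fix k assume "k \<in> {1..int n}"
    then have k: "1 \<le> k" "k \<le> int n" by auto
    then have b: "(0, k) \<in> boundary_pts n" "(int n + 1, k) \<in> boundary_pts n"
      "(k, 0) \<in> boundary_pts n" "(k, int n + 1) \<in> boundary_pts n"
      by (auto simp: boundary_pts_def)
    show "(x (0, k) = f 0 k \<and> hor (snd W) 0 k * (x (0, k) - x (1, k)) = hor \<gamma> 0 k * (f 0 k - f 1 k)) \<and>
      (x (int n + 1, k) = f (int n + 1) k \<and>
        hor (snd W) (int n) k * (x (int n + 1, k) - x (int n, k)) = hor \<gamma> (int n) k * (f (int n + 1) k - f (int n) k)) \<and>
      (x (k, 0) = f k 0 \<and> ver (snd W) k 0 * (x (k, 0) - x (k, 1)) = ver \<gamma> k 0 * (f k 0 - f k 1)) \<and>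
      x (k, int n + 1) = f k (int n + 1) \<and>
        ver (snd W) k (int n) * (x (k, int n + 1) - x (k, int n)) = ver \<gamma> k (int n) * (f k (int n + 1) - f k (int n))"
      using b[THEN xb] b[THEN fl] k
      by (simp add: bnbr_sides[OF k] w hor_def ver_def insert_commute)
  qed
  ultimately show "\<exists>f'. harmonic (int n) (hor (snd W)) (ver (snd W)) f' \<and>
      same_cauchy_data (int n) (hor \<gamma>) (ver \<gamma>) f (hor (snd W)) (ver (snd W)) f'"
    by blast
qed

lemma fitting_second_layer:
  assumes g: "conductivity_profile n \<gamma>"
    and fit: "\<And>ub. ub \<in> vecs (boundary_pts n) \<Longrightarrow> fits n \<gamma> W ub"
    and e: "e \<in> edges n"
  shows "snd W e = \<gamma> e"
proof -
  note R = reproducing_weights_unique[OF hidden_layer_reproduces[OF g fit]]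
  note P = conductivity_positive[OF g]
  have h: "hor (snd W) i j = hor \<gamma> i j" if "0 \<le> i" "i \<le> int n" "1 \<le> j" "j \<le> int n" for i j
    by (rule R(1)[OF _ _ _ that]) (use P in force)+
  have v: "ver (snd W) i j = ver \<gamma> i j" if "1 \<le> i" "i \<le> int n" "0 \<le> j" "j \<le> int n" for i j
    by (rule R(2)[OF _ _ _ that]) (use P in force)+
  from e show ?thesis
    by (cases rule: edge_cases) (use h v in \<open>auto simp: hor_def ver_def\<close>)
qed

text \<open>
  Once the second layer is \<open>\<gamma>\<close>, vanishing interior outputs are the equations of the Dirichlet problem.
\<close>

lemma fitting_hidden_layer:
  assumes g: "conductivity_profile n \<gamma>"
    and W2: "\<And>e. e \<in> edges n \<Longrightarrow> snd W e = \<gamma> e"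
    and fit: "fits n \<gamma> W ub"
    and u: "dirichlet_solution n \<gamma> ub u"
  shows "hidden_tilde n (fst W) ub = u"
proof (rule dirichlet_unique[OF g _ u])
  obtain y where y: "\<forall>r\<in>closure_pts n. network_output n W ub y r = 0"
    using fit by (auto simp: fits_def)
  let ?x = "hidden_tilde n (fst W) ub"
  show "dirichlet_solution n \<gamma> ub ?x"
    unfolding dirichlet_solution_def
  proof (intro conjI ballI)
    fix p assume p: "p \<in> interior_pts n"
    have "(\<Sum>q\<in>nbrs n p. \<gamma> {q, p} * (?x q - ?x p)) = (\<Sum>q\<in>nbrs n p. snd W {q, p} * (?x q - ?x p))"
      by (intro sum.cong) (auto simp: W2 edge_iff_nbrs)
    also have "\<dots> = network_output n W ub y p" by (rule network_output_interior[OF p, symmetric])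
    also have "\<dots> = 0" using y p by (simp add: closure_pts_def)
    finally show "(\<Sum>q\<in>nbrs n p. \<gamma> {q, p} * (?x q - ?x p)) = 0" .
  qed (auto simp: vecs_def hidden_tilde_def closure_pts_def)
qed

lemma coeff_matrix_of_conductivity:
  assumes W: "\<And>e. e \<in> edges n \<Longrightarrow> W e = \<gamma> e" and r: "r \<in> closure_pts n" and p: "p \<in> closure_pts n"
  shows "({p, r} \<in> edges n \<and> r \<in> interior_pts n \<longrightarrow> coeff_matrix n W r p = \<gamma> {p, r}) \<and>
    ({p, r} \<in> edges n \<and> r \<in> boundary_pts n \<longrightarrow> coeff_matrix n W r p = - \<gamma> {p, r}) \<and>
    ({p, r} \<notin> edges n \<and> p \<noteq> r \<longrightarrow> coeff_matrix n W r p = 0) \<and>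
    (p = r \<and> r \<in> interior_pts n \<longrightarrow> coeff_matrix n W r p = - (\<Sum>q\<in>nbrs n r. \<gamma> {q, r})) \<and>
    (\<forall>q. p = r \<and> r \<in> boundary_pts n \<and> {q} = nbrs n r \<longrightarrow> coeff_matrix n W r p = \<gamma> {q, r})"
proof -
  have d: "r \<in> boundary_pts n \<Longrightarrow> r \<notin> interior_pts n" using interior_boundary_disjoint[of n] by blast
  have s: "{r, r} \<notin> edges n" using not_self_nbr[of r n] by (simp add: edge_iff_nbrs del: insert_absorb2)
  have "(\<Sum>q\<in>nbrs n r. W {q, r}) = (\<Sum>q\<in>nbrs n r. \<gamma> {q, r})"
    by (intro sum.cong) (auto simp: W edge_iff_nbrs)
  moreover have "W {bnbr n r, r} = \<gamma> {q, r}" if "{q} = nbrs n r" for q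
  proof -
    have "bnbr n r = q" using that[symmetric] by (simp add: bnbr_def)
    moreover have "{q, r} \<in> edges n" using that by (auto simp: edge_iff_nbrs)
    ultimately show ?thesis by (simp add: W)
  qed
  ultimately show ?thesis
    using d s W by (auto simp: coeff_matrix_def)
qed

theorem corollary4p2:
  fixes n m :: nat and \<alpha> :: real
    and \<gamma> :: "point set \<Rightarrow> real"
    and d :: "nat \<Rightarrow> (point \<Rightarrow> real) \<times> (point \<Rightarrow> real)"
  assumes "n \<ge> 1"
    and "\<alpha> > 0"
    and "conductivity_profile n \<gamma>"
    and "m \<ge> 4 * n"
    and "\<And>k. k \<in> {1..m} \<Longrightarrow> cauchy_pair n \<gamma> (d k)"
    and "\<exists>S \<subseteq> (\<lambda>k. fst (d k)) ` {1..m}. basis_of_vecs (boundary_pts n) S"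
  shows "\<exists>W. is_minimum n \<alpha> m d W \<and> loss n \<alpha> m d W = 0 \<and>
    (\<forall>W'. is_minimum n \<alpha> m d W' \<longrightarrow> W' = W) \<and>
    (\<forall>r\<in>closure_pts n. \<forall>p\<in>closure_pts n.
       ({p, r} \<in> edges n \<and> r \<in> interior_pts n \<longrightarrow>
          coeff_matrix n (snd W) r p = \<gamma> {p, r}) \<and>
       ({p, r} \<in> edges n \<and> r \<in> boundary_pts n \<longrightarrow>
          coeff_matrix n (snd W) r p = - \<gamma> {p, r}) \<and>
       ({p, r} \<notin> edges n \<and> p \<noteq> r \<longrightarrow>
          coeff_matrix n (snd W) r p = 0) \<and>
       (p = r \<and> r \<in> interior_pts n \<longrightarrow>
          coeff_matrix n (snd W) r p = - (\<Sum>q\<in>nbrs n r. \<gamma> {q, r})) \<and>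
       (\<forall>q. p = r \<and> r \<in> boundary_pts n \<and> {q} = nbrs n r \<longrightarrow>
          coeff_matrix n (snd W) r p = \<gamma> {q, r})) \<and>
    (\<forall>e\<in>edges n. snd W e = \<gamma> e) \<and>
    (\<forall>ub\<in>vecs (boundary_pts n). \<forall>u. dirichlet_solution n \<gamma> ub u \<longrightarrow>
       (\<forall>q\<in>interior_pts n. u q = (\<Sum>p\<in>boundary_pts n. fst W (p, q) * ub p)))"
proof -
  note g = assms(3)
  have m: "m \<ge> 1" using assms(1,4) by simp
  obtain S where S: "S \<subseteq> (\<lambda>k. fst (d k)) ` {1..m}" "basis_of_vecs (boundary_pts n) S"
    using assms(6) by blast
  have "\<exists>u. dirichlet_solution n \<gamma> (fst (d k)) u" if "k \<in> {1..m}" for k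
    using assms(5)[OF that] by (auto simp: cauchy_pair_def)
  then have "S \<subseteq> {ub. \<exists>u. dirichlet_solution n \<gamma> ub u}" using S(1) by blast
  from basis_in_subspace[OF S(2) this subspace_dirichlet]
  have ex: "\<exists>u. dirichlet_solution n \<gamma> ub u" if "ub \<in> vecs (boundary_pts n)" for ub
    using that by blast
  define unit :: "point \<Rightarrow> point \<Rightarrow> real" where "unit p = (\<lambda>x. if x = p then 1 else 0)" for p
  define sol where "sol p = (SOME u. dirichlet_solution n \<gamma> (unit p) u)" for p
  have unit: "unit p \<in> vecs (boundary_pts n)" if "p \<in> boundary_pts n" for p
    using that by (auto simp: unit_def vecs_def)
  have sol: "dirichlet_solution n \<gamma> (unit p) (sol p)" if "p \<in> boundary_pts n" for p
    unfolding sol_def using ex[OF unit[OF that]] by (rule someI_ex)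
  \<comment> \<open>The candidate: rows of the solution matrix, and \<open>\<gamma>\<close> cut off outside the edges.\<close>
  define W1 where "W1 = (\<lambda>(p, q). if p \<in> boundary_pts n \<and> q \<in> interior_pts n then sol p q else 0)"
  define W2 where "W2 e = (if e \<in> edges n then \<gamma> e else 0)" for e
  define W :: params where "W = (W1, W2)"
  have W2: "snd W e = \<gamma> e" if "e \<in> edges n" for e using that by (simp add: W_def W2_def)
  have space: "W \<in> param_space n" by (auto simp: W_def W1_def W2_def param_space_def vecs_def)
  have sup: "u x = (\<Sum>p\<in>boundary_pts n. ub p * sol p x)" if u: "dirichlet_solution n \<gamma> ub u" for ub u x
  proof -
    have "dirichlet_solution n \<gamma> (\<lambda>x. \<Sum>p\<in>boundary_pts n. ub p * unit p x) (\<lambda>x. \<Sum>p\<in>boundary_pts n. ub p * sol p x)"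
      by (intro dirichlet_sum finite_pts sol)
    then have "dirichlet_solution n \<gamma> ub (\<lambda>x. \<Sum>p\<in>boundary_pts n. ub p * sol p x)"
      by (simp add: dirichlet_solution_def unit_def if_distrib sum.delta' finite_pts cong: if_cong)
    from dirichlet_unique[OF g u this] show ?thesis by metis
  qed
  have rep: "u q = (\<Sum>p\<in>boundary_pts n. fst W (p, q) * ub p)"
    if "dirichlet_solution n \<gamma> ub u" "q \<in> interior_pts n" for ub u q
    using sup[OF that(1), of q] that(2) by (simp add: W_def W1_def mult.commute)
  have hid: "hidden_tilde n (fst W) ub = u" if u: "dirichlet_solution n \<gamma> ub u" for ub u
  proof
    fix x
    have "u x = 0" if "x \<notin> interior_pts n" "x \<notin> boundary_pts n"
      using u that unfolding dirichlet_solution_def vecs_def closure_pts_def by blast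
    then show "hidden_tilde n (fst W) ub x = u x"
      using u rep[OF u, of x] by (auto simp: hidden_tilde_def dirichlet_solution_def)
  qed
  have "network_output n W (fst (d k)) (snd (d k)) r = 0" if k: "k \<in> {1..m}" and r: "r \<in> closure_pts n" for k r
  proof -
    obtain u where u: "dirichlet_solution n \<gamma> (fst (d k)) u"
      "\<forall>q\<in>boundary_pts n. snd (d k) q = \<gamma> {q, bnbr n q} * (u q - u (bnbr n q))"
      using assms(5)[OF k] by (auto simp: cauchy_pair_def)
    have "(\<Sum>p\<in>nbrs n r. snd W {p, r} * (u p - u r)) = (\<Sum>p\<in>nbrs n r. \<gamma> {p, r} * (u p - u r))"
      by (intro sum.cong) (auto simp: W2 edge_iff_nbrs)
    moreover have "snd W {bnbr n r, r} = \<gamma> {r, bnbr n r}" if "r \<in> boundary_pts n"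
    proof -
      have "{bnbr n r, r} \<in> edges n" using nbrs_boundary(1)[OF that] by (simp add: edge_iff_nbrs)
      from W2[OF this] show ?thesis by (simp add: insert_commute)
    qed
    ultimately show ?thesis
      using u r
      by (auto simp: network_output_interior network_output_boundary hid[OF u(1)] dirichlet_solution_def
          closure_pts_def)
  qed
  then have zero: "loss n \<alpha> m d W = 0" using loss_zero_iff[OF assms(2) m] by blast
  have min: "is_minimum n \<alpha> m d W"
    using space zero loss_nonneg[OF assms(2)] by (auto simp: is_minimum_def is_arg_min_def not_less)
  have uniq: "W' = W" if W': "is_minimum n \<alpha> m d W'" for W'
  proof -
    have sp: "W' \<in> param_space n" and "loss n \<alpha> m d W' \<le> loss n \<alpha> m d W"
      using W' space unfolding is_minimum_def is_arg_min_def by (meson linorder_not_less)+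
    then have "loss n \<alpha> m d W' = 0" using zero loss_nonneg[OF assms(2)] by (simp add: order_antisym)
    then have out: "network_output n W' (fst (d k)) (snd (d k)) r = 0" if "k \<in> {1..m}" "r \<in> closure_pts n" for k r
      using loss_zero_iff[OF assms(2) m] that by blast
    have "fits n \<gamma> W' (fst (d k))" if k: "k \<in> {1..m}" for k
    proof -
      obtain u where u: "dirichlet_solution n \<gamma> (fst (d k)) u"
        "\<forall>q\<in>boundary_pts n. snd (d k) q = \<gamma> {q, bnbr n q} * (u q - u (bnbr n q))"
        using assms(5)[OF k] by (auto simp: cauchy_pair_def)
      then show ?thesis
        unfolding fits_def using out[OF k]
          network_output_cong[of n "\<lambda>q. \<gamma> {q, bnbr n q} * (u q - u (bnbr n q))" "snd (d k)" W' "fst (d k)"]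
        by auto
    qed
    then have "S \<subseteq> {ub. fits n \<gamma> W' ub}" using S(1) by blast
    from basis_in_subspace[OF S(2) this subspace_fits]
    have fit: "fits n \<gamma> W' ub" if "ub \<in> vecs (boundary_pts n)" for ub using that by blast
    have e: "snd W' e = \<gamma> e" if "e \<in> edges n" for e by (rule fitting_second_layer[OF g fit that])
    have "fst W' (p, q) = fst W (p, q)" if p: "p \<in> boundary_pts n" and q: "q \<in> interior_pts n" for p q
    proof -
      have "hidden_tilde n (fst W') (unit p) q = hidden_tilde n (fst W) (unit p) q"
        using fitting_hidden_layer[OF g e fit[OF unit[OF p]] sol[OF p]] hid[OF sol[OF p]] by simp
      moreover have "hidden_tilde n V (unit p) q = V (p, q)" for V
        using p q interior_boundary_disjoint[of n]
        by (auto simp: hidden_tilde_def unit_def if_distrib sum.delta finite_pts cong: if_cong)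
      ultimately show ?thesis by simp
    qed
    then have "fst W' x = fst W x" for x
    proof (cases "x \<in> boundary_pts n \<times> interior_pts n")
      case False
      with sp space have "fst W' x = 0" "fst W x = 0" unfolding param_space_def vecs_def mem_Times_iff by blast+
      then show ?thesis by simp
    qed auto
    moreover have "snd W' x = snd W x" for x
    proof (cases "x \<in> edges n")
      case False
      with sp space have "snd W' x = 0" "snd W x = 0" unfolding param_space_def vecs_def mem_Times_iff by blast+
      then show ?thesis by simp
    qed (simp add: e W2)
    ultimately show ?thesis by (simp add: prod_eq_iff fun_eq_iff)
  qed
  note coeff = coeff_matrix_of_conductivity[of n "snd W" \<gamma>, OF W2]
  show ?thesis
    by (rule exI[of _ W], rule conjI[OF min], rule conjI[OF zero], rule conjI[OF _ conjI[OF _ conjI]])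
      (blast intro: uniq, intro ballI, rule coeff, assumption+, use W2 in blast, use rep in blast)
qed

end
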